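(* Let $(\mathcal X,d)$ be a compact metric space, let $C:\mathcal X\times\mathcal X\to\mathbb R$ be a symmetric, $L$-Lipschitz cost function, and let $\alpha,\beta\in\mathcal P(\mathcal X)$. Fix a batch size $n\ge 1$ and initial potentials $(\hat f_0,\hat g_0)\in\mathcal C(\mathcal X)^2$. Then the randomized Sinkhorn iterations $$\hat f_{t+1}=T_{\hat\beta_t}(\hat g_t),\qquad \hat g_{t+1}=T_{\hat\alpha_t}(\hat f_t),\qquad t\ge 0,$$ yield a time-homogeneous Markov chain $(\hat f_t,\hat g_t)_t$, where $(\hat f_t,\hat g_t)$ is measurable with respect to $(\hat\alpha_s,\hat\beta_s)_{s\le t}$, and this chain converges in law towards a stationary distribution, i.e. the law of some random pair $(f_\infty,g_\infty)$ of continuous functions on $\mathcal X$; this stationary distribution is independent of the initialization $(\hat f_0,\hat g_0)$.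
   Context: $\mathcal C(\mathcal X)$ is the set of continuous real functions on $\mathcal X$, $\mathcal P(\mathcal X)$ the set of Borel probability measures on $\mathcal X$. For $h\in\mathcal C(\mathcal X)$ and $\mu\in\mathcal P(\mathcal X)$ the soft $C$-transform is the continuous function $T_\mu(h)(\cdot)=-\log\int_{\mathcal X}\exp(h(y)-C(\cdot,y))\,d\mu(y)$ (the regularization parameter is $\varepsilon=1$). Potentials are measured with the variation norm $\|f\|_{\mathrm{var}}=\max_x f(x)-\min_x f(x)$; functions endowed with this norm are only considered up to an additive constant. Thus the state space is $\mathcal C(\mathcal X)\times\mathcal C(\mathcal X)$, each factor taken modulo additive constants, with metric $\rho((f_1,g_1),(f_2,g_2))=\|f_1-f_2\|_{\mathrm{var}}+\|g_1-g_2\|_{\mathrm{var}}$. The maps $T_\mu$ are well defined on it since $T_\mu(h+c)=T_\mu(h)-c$ for constants $c$. The random measures $\hat\alpha_t=\frac1n\sum_{i=nt+1}^{n(t+1)}\delta_{x_i}$ and $\hat\beta_t=\frac1n\sum_{i=nt+1}^{n(t+1)}\delta_{y_i}$, $t\ge0$, are empirical measures of successive mini-batches, where $(x_i)_i$ are i.i.d. samples from $\alpha$ and $(y_i)_i$ are i.i.d. samples from $\beta$, all independent. *)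

theory Defs
  imports "HOL-Probability.Probability"
begin

section \<open>Potentials modulo additive constants\<close>

text \<open>On a compact space the supremum and the infimum are attained by a continuous function,
  see \<open>var_norm_attained\<close> below.\<close>

definition var_norm :: "('a \<Rightarrow> real) \<Rightarrow> real" where
  "var_norm f = (SUP x. f x) - (INF x. f x)"

lemma var_norm_le_iff:
  fixes f :: "'a \<Rightarrow> real"
  assumes "bounded (range f)"
  shows "var_norm f \<le> b \<longleftrightarrow> (\<forall>x y. f x - f y \<le> b)"
proof
  have bdd: "bdd_above (range f)" "bdd_below (range f)"
    using assms by (auto intro: bounded_imp_bdd_above bounded_imp_bdd_below)
  {
    assume le: "var_norm f \<le> b"
    show "\<forall>x y. f x - f y \<le> b"
    proof (intro allI)
      fix x y
      have "f x \<le> (SUP x. f x)" "(INF x. f x) \<le> f y"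
        using bdd by (auto intro: cSUP_upper cINF_lower)
      then show "f x - f y \<le> b" using le by (simp add: var_norm_def)
    qed
  next
    assume le: "\<forall>x y. f x - f y \<le> b"
    have "(SUP x. f x) \<le> b + f y" for y
      using le by (intro cSUP_least) (auto simp: algebra_simps)
    then have "(SUP x. f x) - b \<le> (INF y. f y)"
      by (intro cINF_greatest) (auto simp: algebra_simps)
    then show "var_norm f \<le> b" by (simp add: var_norm_def)
  }
qed

lemma var_norm_upper:
  fixes f :: "'a \<Rightarrow> real"
  assumes "bounded (range f)"
  shows "f x - f y \<le> var_norm f"
  using var_norm_le_iff[OF assms] by blast

lemma var_norm_attained:
  fixes f :: "'a::topological_space \<Rightarrow> real"
  assumes "compact (UNIV :: 'a set)" "continuous_on UNIV f"
  obtains x y where "\<And>z. f z \<le> f x" "\<And>z. f y \<le> f z" "var_norm f = f x - f y"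
proof -
  obtain x where x: "\<And>z. f z \<le> f x"
    using continuous_attains_sup[OF assms(1) _ assms(2)] by auto
  obtain y where y: "\<And>z. f y \<le> f z"
    using continuous_attains_inf[OF assms(1) _ assms(2)] by auto
  have "(SUP z. f z) = f x" "(INF z. f z) = f y"
    using x y by (auto intro!: cSup_eq_maximum cInf_eq_minimum)
  with x y show thesis by (intro that) (auto simp: var_norm_def)
qed

text \<open>On a compact space every continuous function is bounded, so that the type of bounded
  continuous functions is the whole of C(X).\<close>

definition equal_mod_const :: "('a::topological_space \<Rightarrow>\<^sub>C real) \<Rightarrow> ('a \<Rightarrow>\<^sub>C real) \<Rightarrow> bool" where
  "equal_mod_const f g \<longleftrightarrow> (\<exists>c. \<forall>x. f x = g x + c)"

quotient_type (overloaded) 'a potential = "'a::topological_space \<Rightarrow>\<^sub>C real" / equal_mod_const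
proof (rule equivpI)
  show "reflp (equal_mod_const :: ('a \<Rightarrow>\<^sub>C real) \<Rightarrow> _)"
    by (auto simp: equal_mod_const_def intro!: reflpI exI[of _ 0])
  show "symp (equal_mod_const :: ('a \<Rightarrow>\<^sub>C real) \<Rightarrow> _)"
  proof (rule sympI)
    fix f g :: "'a \<Rightarrow>\<^sub>C real"
    assume "equal_mod_const f g"
    then obtain c where "\<forall>x. f x = g x + c" unfolding equal_mod_const_def ..
    then show "equal_mod_const g f"
      unfolding equal_mod_const_def by (intro exI[of _ "- c"]) simp
  qed
  show "transp (equal_mod_const :: ('a \<Rightarrow>\<^sub>C real) \<Rightarrow> _)"
  proof (rule transpI)
    fix f g h :: "'a \<Rightarrow>\<^sub>C real"
    assume "equal_mod_const f g" "equal_mod_const g h"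
    then obtain c d where "\<forall>x. f x = g x + c" "\<forall>x. g x = h x + d"
      unfolding equal_mod_const_def by blast
    then show "equal_mod_const f h"
      unfolding equal_mod_const_def by (intro exI[of _ "c + d"]) simp
  qed
qed

lemma bounded_range_diff_bcontfun:
  fixes f g :: "'a::topological_space \<Rightarrow>\<^sub>C real"
  shows "bounded (range (\<lambda>x. f x - g x))"
  using bounded_minus_comp[OF bounded_apply_bcontfun[of f] bounded_apply_bcontfun[of g]] by simp

instantiation potential :: (topological_space) metric_space
begin

lift_definition dist_potential :: "'a potential \<Rightarrow> 'a potential \<Rightarrow> real"
  is "\<lambda>f g. var_norm (\<lambda>x. apply_bcontfun f x - apply_bcontfun g x)"
proof -
  fix f f' g g' :: "'a \<Rightarrow>\<^sub>C real"
  assume "equal_mod_const f f'" "equal_mod_const g g'"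
  then obtain c d where cd: "\<And>x. f x = f' x + c" "\<And>x. g x = g' x + d"
    unfolding equal_mod_const_def by blast
  have "var_norm (\<lambda>x. f x - g x) \<le> b \<longleftrightarrow> var_norm (\<lambda>x. f' x - g' x) \<le> b" for b
    unfolding var_norm_le_iff[OF bounded_range_diff_bcontfun] by (simp add: cd algebra_simps)
  then show "var_norm (\<lambda>x. f x - g x) = var_norm (\<lambda>x. f' x - g' x)"
    by (meson order_antisym order_refl)
qed

definition uniformity_potential :: "('a potential \<times> 'a potential) filter"
  where "uniformity_potential = (INF e\<in>{0 <..}. principal {(x, y). dist x y < e})"

definition open_potential :: "'a potential set \<Rightarrow> bool"
  where "open_potential S = (\<forall>x\<in>S. \<forall>\<^sub>F (x', y) in uniformity. x' = x \<longrightarrow> y \<in> S)"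

instance
proof
  fix p q r :: "'a potential"
  show "dist p q = 0 \<longleftrightarrow> p = q"
  proof transfer
    fix f g :: "'a \<Rightarrow>\<^sub>C real"
    note le = var_norm_le_iff[OF bounded_range_diff_bcontfun[of f g]]
    have nn: "0 \<le> var_norm (\<lambda>x. f x - g x)"
      using var_norm_upper[OF bounded_range_diff_bcontfun[of f g], of undefined undefined] by simp
    show "(var_norm (\<lambda>x. f x - g x) = 0) = equal_mod_const f g"
      unfolding equal_mod_const_def
    proof
      assume "var_norm (\<lambda>x. f x - g x) = 0"
      then have "\<forall>x y. (f x - g x) - (f y - g y) \<le> 0" using le[of 0] by simp
      then have "\<forall>x. f x = g x + (f undefined - g undefined)"
        by (metis (no_types, lifting) add.commute diff_add_cancel diff_le_0_iff_le order_antisym)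
      then show "\<exists>c. \<forall>x. f x = g x + c" by blast
    next
      assume "\<exists>c. \<forall>x. f x = g x + c"
      then have "var_norm (\<lambda>x. f x - g x) \<le> 0" unfolding le by auto
      with nn show "var_norm (\<lambda>x. f x - g x) = 0" by simp
    qed
  qed
  show "dist p q \<le> dist p r + dist q r"
  proof transfer
    fix f g h :: "'a \<Rightarrow>\<^sub>C real"
    have "(f x - g x) - (f y - g y) \<le> var_norm (\<lambda>x. f x - h x) + var_norm (\<lambda>x. g x - h x)" for x y
      using var_norm_upper[OF bounded_range_diff_bcontfun[of f h], of x y]
        var_norm_upper[OF bounded_range_diff_bcontfun[of g h], of y x] by simp
    then show "var_norm (\<lambda>x. f x - g x) \<le> var_norm (\<lambda>x. f x - h x) + var_norm (\<lambda>x. g x - h x)"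
      unfolding var_norm_le_iff[OF bounded_range_diff_bcontfun[of f g]] by blast
  qed
qed (simp_all only: uniformity_potential_def open_potential_def)

end

text \<open>The state space of the chain is the product \<open>'a potential \<times> 'a potential\<close>. The library
  equips products with the Euclidean combination of the two distances; the sum of the two
  distances induces the same topology, hence the same Borel sets and the same convergence in law.\<close>

lemma open_prod_dist_sum_iff:
  fixes S :: "('b::metric_space \<times> 'c::metric_space) set"
  shows "open S \<longleftrightarrow>
    (\<forall>p\<in>S. \<exists>e>0. \<forall>q. dist (fst q) (fst p) + dist (snd q) (snd p) < e \<longrightarrow> q \<in> S)"
proof -
  have le: "dist q p \<le> dist (fst q) (fst p) + dist (snd q) (snd p)" for p q :: "'b \<times> 'c"
    by (simp add: dist_prod_def sqrt_sum_squares_le_sum)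
  have ge: "dist (fst q) (fst p) + dist (snd q) (snd p) \<le> 2 * dist q p" for p q :: "'b \<times> 'c"
    using dist_fst_le[of q p] dist_snd_le[of q p] by simp
  show ?thesis
    unfolding open_dist
  proof (intro ball_cong refl iffI)
    fix p assume "\<exists>e>0. \<forall>q. dist q p < e \<longrightarrow> q \<in> S"
    then show "\<exists>e>0. \<forall>q. dist (fst q) (fst p) + dist (snd q) (snd p) < e \<longrightarrow> q \<in> S"
      using le by (meson le_less_trans)
  next
    fix p assume "\<exists>e>0. \<forall>q. dist (fst q) (fst p) + dist (snd q) (snd p) < e \<longrightarrow> q \<in> S"
    then obtain e where e: "e > 0"
      "\<And>q. dist (fst q) (fst p) + dist (snd q) (snd p) < e \<Longrightarrow> q \<in> S" by blast
    have "q \<in> S" if "dist q p < e / 2" for q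
      using that ge[of q p] by (intro e(2)) simp
    with \<open>e > 0\<close> show "\<exists>e>0. \<forall>q. dist q p < e \<longrightarrow> q \<in> S"
      by (intro exI[of _ "e / 2"]) simp
  qed
qed

section \<open>Soft C-transform\<close>

definition soft_ctransform ::
    "('a \<Rightarrow> 'a \<Rightarrow> real) \<Rightarrow> 'a measure \<Rightarrow> ('a::topological_space \<Rightarrow>\<^sub>C real) \<Rightarrow> ('a \<Rightarrow>\<^sub>C real)" where
  "soft_ctransform C \<mu> h = Bcontfun (\<lambda>x. - ln (\<integral>y. exp (h y - C x y) \<partial>\<mu>))"

text \<open>For a Lipschitz cost on a compact space the function above is indeed continuous, so that
  \<open>Bcontfun\<close> does not change it.\<close>

lemma apply_soft_ctransform:
  fixes C :: "'a::metric_space \<Rightarrow> 'a \<Rightarrow> real" and h :: "'a \<Rightarrow>\<^sub>C real"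
  assumes compact: "compact (UNIV :: 'a set)"
    and lip: "L-lipschitz_on UNIV (case_prod C)"
    and \<mu>: "\<mu> \<in> space (prob_algebra borel)"
  shows "soft_ctransform C \<mu> h x = - ln (\<integral>y. exp (h y - C x y) \<partial>\<mu>)"
proof -
  interpret \<mu>: prob_space \<mu> using \<mu> by (simp add: space_prob_algebra)
  have sets_\<mu>: "sets \<mu> = sets borel" using \<mu> by (simp add: space_prob_algebra)
  then have space_\<mu>: "space \<mu> = UNIV" by (metis sets_eq_imp_space_eq space_borel)
  define I where "I x = (\<integral>y. exp (h y - C x y) \<partial>\<mu>)" for x
  have "continuous_on UNIV (case_prod C)" using lip by (rule lipschitz_on_continuous_on)
  then have "continuous_on UNIV (\<lambda>y. case_prod C (x, y))" for x
    by (rule continuous_on_compose2) (auto intro!: continuous_intros)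
  then have contC: "continuous_on UNIV (C x)" for x by simp
  have cont: "continuous_on UNIV (\<lambda>y. h y - C x y)" for x
    by (intro continuous_intros contC) auto
  have bnd: "\<exists>B. \<forall>y. \<bar>h y - C x y\<bar> \<le> B" for x
    using compact_imp_bounded[OF compact_continuous_image[OF cont[of x] compact]]
    by (auto simp: bounded_iff)
  have meas: "(\<lambda>y. exp (h y - C x y)) \<in> borel_measurable \<mu>" for x
    unfolding measurable_cong_sets[OF sets_\<mu> refl]
    by (intro borel_measurable_continuous_onI continuous_intros contC) auto
  have int: "integrable \<mu> (\<lambda>y. exp (h y - C x y))" for x
  proof -
    obtain B where "\<And>y. \<bar>h y - C x y\<bar> \<le> B" using bnd by blast
    then have "h y - C x y \<le> B" for y by (meson abs_le_D1)
    then show ?thesis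
      by (intro \<mu>.integrable_const_bound[where B="exp B"] meas) simp
  qed
  have pos: "0 < I x" for x
  proof -
    obtain B where "\<And>y. \<bar>h y - C x y\<bar> \<le> B" using bnd by blast
    then have "- B \<le> h y - C x y" for y by (meson abs_le_D2 minus_le_iff)
    then have "exp (- B) \<le> I x"
      unfolding I_def by (intro \<mu>.integral_ge_const int) simp
    then show ?thesis by (rule less_le_trans[rotated]) simp
  qed
  have L: "0 \<le> L" using lip by (rule lipschitz_on_nonneg)
  have step: "ln (I x) - ln (I x') \<le> L * dist x x'" for x x'
  proof -
    have *: "C x' y - C x y \<le> L * dist x x'" for y
      using lipschitz_onD[OF lip, of "(x, y)" "(x', y)"]
      by (auto simp: dist_prod_def dist_real_def)
    have "h y - C x y \<le> L * dist x x' + (h y - C x' y)" for y using *[of y] by simp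
    then have "exp (h y - C x y) \<le> exp (L * dist x x') * exp (h y - C x' y)" for y
      by (metis exp_add exp_le_cancel_iff)
    then have "I x \<le> (\<integral>y. exp (L * dist x x') * exp (h y - C x' y) \<partial>\<mu>)"
      unfolding I_def by (intro integral_mono int integrable_mult_right) auto
    also have "\<dots> = exp (L * dist x x') * I x'" by (simp add: I_def)
    finally have "ln (I x) \<le> ln (exp (L * dist x x') * I x')"
      using pos[of x] by (intro ln_mono) auto
    also have "\<dots> = L * dist x x' + ln (I x')"
      using pos[of x'] by (simp add: ln_mult)
    finally show ?thesis by simp
  qed
  have "L-lipschitz_on UNIV (\<lambda>x. - ln (I x))"
  proof (rule lipschitz_onI[OF _ L])
    fix x x' :: 'a
    show "dist (- ln (I x)) (- ln (I x')) \<le> L * dist x x'"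
      using step[of x x'] step[of x' x] by (simp add: dist_real_def dist_commute abs_le_iff)
  qed
  then have c: "continuous_on UNIV (\<lambda>x. - ln (I x))" by (rule lipschitz_on_continuous_on)
  then have "(\<lambda>x. - ln (I x)) \<in> bcontfun"
    using compact_imp_bounded[OF compact_continuous_image[OF c compact]] by (simp add: bcontfun_def)
  then show ?thesis
    by (simp add: soft_ctransform_def Bcontfun_inverse I_def)
qed

section \<open>Randomized Sinkhorn iterations\<close>

text \<open>The empirical measure of the \<open>t\<close>-th batch of size \<open>n\<close>, as the image under \<open>x\<close> of the
  uniform distribution on the indices of the batch.\<close>

definition minibatch_measure :: "nat \<Rightarrow> (nat \<Rightarrow> 'a::topological_space) \<Rightarrow> nat \<Rightarrow> 'a measure" where
  "minibatch_measure n x t = distr (uniform_count_measure {n * t + 1..n * (t + 1)}) borel x"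

lemma emeasure_minibatch_measure:
  assumes "n \<ge> 1" "A \<in> sets borel"
  shows "emeasure (minibatch_measure n x t) A
    = ennreal (1 / n * (\<Sum>i = n * t + 1..n * (t + 1). indicator A (x i)))"
proof -
  let ?I = "{n * t + 1..n * (t + 1)}"
  have card: "card ?I = n" by simp
  have "x \<in> measurable (uniform_count_measure ?I) borel"
    by (simp add: measurable_def sets_uniform_count_measure space_uniform_count_measure)
  then have "emeasure (minibatch_measure n x t) A
      = emeasure (uniform_count_measure ?I) (x -` A \<inter> ?I)"
    using assms by (simp add: minibatch_measure_def emeasure_distr space_uniform_count_measure)
  also have "\<dots> = ennreal (card (x -` A \<inter> ?I) / card ?I)"
    by (intro emeasure_uniform_count_measure) auto
  also have "real (card (x -` A \<inter> ?I)) = (\<Sum>i\<in>?I. indicator A (x i))"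
    by (simp add: indicator_def sum.If_cases Int_def vimage_def conj_commute)
  finally show ?thesis by (simp only: card) (simp add: mult.commute divide_inverse)
qed

primrec sinkhorn ::
    "('a \<Rightarrow> 'a \<Rightarrow> real) \<Rightarrow> (nat \<Rightarrow> 'a measure) \<Rightarrow> (nat \<Rightarrow> 'a measure) \<Rightarrow>
     ('a::topological_space \<Rightarrow>\<^sub>C real) \<times> ('a \<Rightarrow>\<^sub>C real) \<Rightarrow> nat \<Rightarrow> ('a \<Rightarrow>\<^sub>C real) \<times> ('a \<Rightarrow>\<^sub>C real)"
where
  "sinkhorn C \<mu> \<nu> z 0 = z"
| "sinkhorn C \<mu> \<nu> z (Suc t) =
     (let (f, g) = sinkhorn C \<mu> \<nu> z t
      in (soft_ctransform C (\<nu> t) g, soft_ctransform C (\<mu> t) f))"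

definition potential_pair ::
    "('a::topological_space \<Rightarrow>\<^sub>C real) \<times> ('a \<Rightarrow>\<^sub>C real) \<Rightarrow> 'a potential \<times> 'a potential" where
  "potential_pair = map_prod abs_potential abs_potential"

section \<open>Markov chains and convergence in law\<close>

text \<open>The \<open>\<sigma>\<close>-algebra on the sample space generated by the \<open>S\<close>-valued variables \<open>Y 0, \<dots>, Y t\<close>.\<close>

definition history :: "'w measure \<Rightarrow> 'b measure \<Rightarrow> (nat \<Rightarrow> 'w \<Rightarrow> 'b) \<Rightarrow> nat \<Rightarrow> 'w measure" where
  "history M S Y t =
     vimage_algebra (space M) (\<lambda>\<omega>. \<lambda>s\<in>{..t}. Y s \<omega>) (\<Pi>\<^sub>M s\<in>{..t}. S)"

definition homogeneous_markov_chain ::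
    "'w measure \<Rightarrow> 's measure \<Rightarrow> ('s \<Rightarrow> 's measure) \<Rightarrow> (nat \<Rightarrow> 'w \<Rightarrow> 's) \<Rightarrow> bool" where
  "homogeneous_markov_chain M S K Z \<longleftrightarrow>
     K \<in> S \<rightarrow>\<^sub>M prob_algebra S \<and>
     (\<forall>t. Z t \<in> M \<rightarrow>\<^sub>M S) \<and>
     (\<forall>t. \<forall>A\<in>sets S. AE \<omega> in M.
        real_cond_exp M (history M S Z t) (\<lambda>\<omega>. indicator A (Z (Suc t) \<omega>)) \<omega> = measure (K (Z t \<omega>)) A)"

definition stationary_distribution :: "'s measure \<Rightarrow> ('s \<Rightarrow> 's measure) \<Rightarrow> 's measure \<Rightarrow> bool" where
  "stationary_distribution S K \<pi> \<longleftrightarrow> \<pi> \<in> space (prob_algebra S) \<and> bind \<pi> K = \<pi>"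

definition converges_in_law ::
    "'w measure \<Rightarrow> (nat \<Rightarrow> 'w \<Rightarrow> 's::topological_space) \<Rightarrow> 's measure \<Rightarrow> bool" where
  "converges_in_law M Z \<pi> \<longleftrightarrow>
     (\<forall>\<phi> :: 's \<Rightarrow>\<^sub>C real. (\<lambda>t. \<integral>z. \<phi> z \<partial>distr M borel (Z t)) \<longlonglongrightarrow> (\<integral>z. \<phi> z \<partial>\<pi>))"

end

theory Submission
  imports Defs
begin

text \<open>
  Modulo constants, the soft C-transform contracts the variation norm by a factor
  \<open>1 - exp (- 2 * \<Lambda>)\<close>, where \<open>\<Lambda>\<close> bounds the oscillation of the cost in one variable
  (\<open>soft_ctransform_contraction\<close>). The factor does not depend on the measure. One iteration is
  therefore a random map on pairs of potentials which is Lipschitz with a constant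
  less than 1, and its image stays in a fixed ball, because every transform has oscillation at most
  \<open>\<Lambda>\<close>. The maps of successive iterations are i.i.d., as each is a function of one mini-batch.

  Iterated i.i.d. contractions of a complete space converge in law by an argument of Letac. Write
  \<open>F\<^sub>t\<close> for the map at time \<open>t\<close>. The state \<open>F\<^sub>t (\<dots> (F\<^sub>0 z))\<close> need not converge, but it has the
  same law as the backward iterate \<open>F\<^sub>0 (\<dots> (F\<^sub>t z))\<close>, because the maps are exchangeable
  (\<open>forward_backward_same_law\<close>). The backward iterates form a Cauchy sequence for every realization
  of the noise, and their limit does not depend on \<open>z\<close> (\<open>backward_iterate_tendsto\<close>). Hence the law
  of the state converges weakly to the law of that limit. The latter is stationary: one more map put
  in front of the sequence sends the limit to its image under that map
  (\<open>backward_limit_case_nat\<close>) and does not change the law of the sequence. The Markov property is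
  the independence of the current map from all earlier ones.

  The measurability of the iteration rests on the separability of C(X) for compact X
  (\<open>separable_bcontfun\<close>): it reduces measurability of a random function to that of its values
  (\<open>borel_measurable_bcontfun_pointwise\<close>), and these are integrals against a random measure.
\<close>

section \<open>Iterated random contractions\<close>

primrec forward_iterate :: "('n \<Rightarrow> 'e \<Rightarrow> 'e) \<Rightarrow> nat \<Rightarrow> (nat \<Rightarrow> 'n) \<Rightarrow> 'e \<Rightarrow> 'e" where
  "forward_iterate F 0 s z = z"
| "forward_iterate F (Suc t) s z = F (s t) (forward_iterate F t s z)"

text \<open>A chain driven by noise \<open>s 0, s 1, \<dots>\<close> applies the newest map last. The backward iterate
  uses the same maps but applies the newest map first. For a fixed time both have the same law when
  the noise is i.i.d., yet in general only the backward iterates converge pathwise: a new map perturbs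
  their innermost argument, and the maps around it contract that perturbation.\<close>

primrec backward_iterate :: "('n \<Rightarrow> 'e \<Rightarrow> 'e) \<Rightarrow> nat \<Rightarrow> (nat \<Rightarrow> 'n) \<Rightarrow> 'e \<Rightarrow> 'e" where
  "backward_iterate F 0 s z = z"
| "backward_iterate F (Suc t) s z = F (s 0) (backward_iterate F t (\<lambda>i. s (Suc i)) z)"

lemma forward_iterate_cong:
  "(\<And>i. i < t \<Longrightarrow> s i = s' i) \<Longrightarrow> forward_iterate F t s z = forward_iterate F t s' z"
  by (induction t) simp_all

text \<open>Reversal of the first \<open>t\<close> indices, extended by the identity to a permutation of all indices, so
  that it acts on whole noise sequences and the product measure can be reindexed along it.\<close>

definition reverse_below :: "nat \<Rightarrow> nat \<Rightarrow> nat" where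
  "reverse_below t i = (if i < t then t - Suc i else i)"

lemma inj_reverse_below: "inj (reverse_below t)"
  by (rule injI) (auto simp: reverse_below_def split: if_splits)

lemma backward_iterate_eq_forward_iterate:
  "backward_iterate F t s z = forward_iterate F t (\<lambda>i. s (reverse_below t i)) z"
proof (induction t arbitrary: s)
  case (Suc t)
  have "forward_iterate F t (\<lambda>i. s (Suc (reverse_below t i))) z
      = forward_iterate F t (\<lambda>i. s (reverse_below (Suc t) i)) z"
    by (rule forward_iterate_cong) (auto simp: reverse_below_def Suc_diff_Suc)
  then show ?case by (simp add: Suc.IH) (simp add: reverse_below_def)
qed simp

lemma backward_iterate_dist_le:
  fixes F :: "'n \<Rightarrow> 'e::metric_space \<Rightarrow> 'e"
  assumes contr: "\<And>i z z'. dist (F (s i) z) (F (s i) z') \<le> \<kappa> * dist z z'" and \<kappa>: "0 \<le> \<kappa>"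
  shows "dist (backward_iterate F t s z) (backward_iterate F t s z') \<le> \<kappa> ^ t * dist z z'"
  using contr
proof (induction t arbitrary: s)
  case (Suc t)
  let ?b = "backward_iterate F t (\<lambda>i. s (Suc i))"
  have "dist (F (s 0) (?b z)) (F (s 0) (?b z')) \<le> \<kappa> * dist (?b z) (?b z')"
    by (rule Suc.prems)
  also have "\<dots> \<le> \<kappa> * (\<kappa> ^ t * dist z z')"
    by (intro mult_left_mono Suc.IH Suc.prems \<kappa>)
  finally show ?case by (simp add: mult.assoc)
qed simp

lemma backward_iterate_step_le:
  fixes F :: "'n \<Rightarrow> 'e::metric_space \<Rightarrow> 'e"
  assumes contr: "\<And>i z z'. dist (F (s i) z) (F (s i) z') \<le> \<kappa> * dist z z'" and \<kappa>: "0 \<le> \<kappa>"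
    and bounded: "\<And>i. dist (F (s i) z) z \<le> B"
  shows "dist (backward_iterate F (Suc t) s z) (backward_iterate F t s z) \<le> \<kappa> ^ t * B"
  using contr bounded
proof (induction t arbitrary: s)
  case (Suc t)
  let ?b = "\<lambda>t. backward_iterate F t (\<lambda>i. s (Suc i)) z"
  have "dist (F (s 0) (?b (Suc t))) (F (s 0) (?b t)) \<le> \<kappa> * dist (?b (Suc t)) (?b t)"
    by (rule Suc.prems)
  also have "\<dots> \<le> \<kappa> * (\<kappa> ^ t * B)"
    by (intro mult_left_mono Suc.IH Suc.prems \<kappa>)
  finally show ?case by (simp add: mult.assoc)
qed simp

lemma Cauchy_if_geometric_steps:
  fixes b :: "nat \<Rightarrow> 'e::metric_space"
  assumes step: "\<And>t. dist (b (Suc t)) (b t) \<le> \<kappa> ^ t * B" and \<kappa>: "0 \<le> \<kappa>" "\<kappa> < 1"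
  shows "Cauchy b"
proof -
  have B: "0 \<le> B" using order_trans[OF zero_le_dist step[of 0]] by simp
  have le: "dist (b (m + k)) (b m) \<le> \<kappa> ^ m * (B / (1 - \<kappa>))" for m k
  proof -
    have "dist (b (m + k)) (b m) \<le> (\<Sum>i<k. \<kappa> ^ (m + i) * B)"
    proof (induction k)
      case (Suc k)
      have "dist (b (m + Suc k)) (b m) \<le> dist (b (Suc (m + k))) (b (m + k)) + dist (b (m + k)) (b m)"
        using dist_triangle by simp
      also have "\<dots> \<le> \<kappa> ^ (m + k) * B + (\<Sum>i<k. \<kappa> ^ (m + i) * B)"
        by (intro add_mono step Suc.IH)
      finally show ?case by simp
    qed simp
    also have "\<dots> = \<kappa> ^ m * B * (\<Sum>i<k. \<kappa> ^ i)"
      by (simp add: sum_distrib_left power_add mult_ac)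
    also have "(\<Sum>i<k. \<kappa> ^ i) \<le> 1 / (1 - \<kappa>)"
      using \<kappa> by (subst sum_gp_strict) (simp add: divide_right_mono)
    finally show ?thesis using \<kappa>(1) B by (simp add: mult_left_mono)
  qed
  show ?thesis
  proof (rule metric_CauchyI)
    fix e :: real assume "e > 0"
    have lim: "(\<lambda>m. \<kappa> ^ m * (B / (1 - \<kappa>))) \<longlonglongrightarrow> 0"
      using \<kappa> by (intro tendsto_mult_left_zero LIMSEQ_power_zero) simp
    obtain k where k: "\<And>m. m \<ge> k \<Longrightarrow> \<kappa> ^ m * (B / (1 - \<kappa>)) < e"
      using order_tendstoD(2)[OF lim \<open>e > 0\<close>] by (auto simp: eventually_sequentially)
    have "dist (b m) (b n) < e" if "m \<ge> k" "n \<ge> k" for m n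
    proof (cases "m \<le> n")
      case True
      then show ?thesis using le[of m "n - m"] k[OF that(1)] by (simp add: dist_commute)
    next
      case False
      then show ?thesis using le[of n "m - n"] k[OF that(2)] by simp
    qed
    then show "\<exists>k. \<forall>m\<ge>k. \<forall>n\<ge>k. dist (b m) (b n) < e" by blast
  qed
qed

text \<open>Here \<open>\<nu>\<close> is the law of the noise in one step. The noise ranges over an arbitrary measurable
  space; a uniform contraction rate and a uniformly bounded displacement of one point replace the
  usual integrability conditions. Completeness is a hypothesis on sequences instead of a type class,
  in order to cover quotient spaces and their products.\<close>

locale random_contraction = prob_space \<nu>
  for \<nu> :: "'n measure" +
  fixes F :: "'n \<Rightarrow> 'e::metric_space \<Rightarrow> 'e" and \<kappa> B :: real and z0 :: 'e
  assumes complete: "\<And>b :: nat \<Rightarrow> 'e. Cauchy b \<Longrightarrow> convergent b"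
    and measurable_F: "(\<lambda>(\<xi>, z). F \<xi> z) \<in> \<nu> \<Otimes>\<^sub>M borel \<rightarrow>\<^sub>M borel"
    and contraction: "\<And>\<xi> z z'. \<xi> \<in> space \<nu> \<Longrightarrow> dist (F \<xi> z) (F \<xi> z') \<le> \<kappa> * dist z z'"
    and \<kappa>: "0 \<le> \<kappa>" "\<kappa> < 1"
    and displacement: "\<And>\<xi>. \<xi> \<in> space \<nu> \<Longrightarrow> dist (F \<xi> z0) z0 \<le> B"
begin

interpretation S: sequence_space \<nu> ..

abbreviation noise :: "(nat \<Rightarrow> 'n) measure" where
  "noise \<equiv> \<Pi>\<^sub>M i\<in>UNIV::nat set. \<nu>"

definition transition :: "'e \<Rightarrow> 'e measure" where
  "transition z = distr \<nu> borel (\<lambda>\<xi>. F \<xi> z)"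

definition backward_limit :: "(nat \<Rightarrow> 'n) \<Rightarrow> 'e" where
  "backward_limit s = lim (\<lambda>t. backward_iterate F t s z0)"

definition invariant_law :: "'e measure" where
  "invariant_law = distr noise borel backward_limit"

lemma measurable_F_compose [measurable (raw)]:
  assumes "f \<in> N \<rightarrow>\<^sub>M \<nu>" "g \<in> borel_measurable N"
  shows "(\<lambda>w. F (f w) (g w)) \<in> borel_measurable N"
  using measurable_compose[OF measurable_Pair[OF assms] measurable_F] by simp

lemma noise_space: "s \<in> space noise \<Longrightarrow> s i \<in> space \<nu>"
  by (auto simp: space_PiM)

lemma contraction_continuous: "\<xi> \<in> space \<nu> \<Longrightarrow> continuous_on UNIV (F \<xi>)"
  by (rule lipschitz_on_continuous_on[of \<kappa>], rule lipschitz_onI)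
     (auto intro: contraction \<kappa>)

lemma measurable_forward_iterate:
  "(\<lambda>s. forward_iterate F t s z) \<in> borel_measurable noise"
  by (induction t) simp_all

text \<open>Consecutive backward iterates from \<open>z0\<close> differ by at most \<open>\<kappa> ^ t * B\<close>, so they form a Cauchy
  sequence. The iterates from two starting points are at distance at most
  \<open>\<kappa> ^ t * dist z z0\<close> after \<open>t\<close> steps, so that the limit forgets the start. There is no exceptional null set.\<close>

lemma backward_iterate_tendsto:
  assumes s: "s \<in> space noise"
  shows "(\<lambda>t. backward_iterate F t s z) \<longlonglongrightarrow> backward_limit s"
proof -
  note contr = contraction[OF noise_space[OF s]]
  have "Cauchy (\<lambda>t. backward_iterate F t s z0)"
  proof (rule Cauchy_if_geometric_steps[OF _ \<kappa>])
    show "dist (backward_iterate F (Suc t) s z0) (backward_iterate F t s z0) \<le> \<kappa> ^ t * B" for t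
      by (intro backward_iterate_step_le contr \<kappa> displacement noise_space[OF s])
  qed
  then have lim: "(\<lambda>t. backward_iterate F t s z0) \<longlonglongrightarrow> backward_limit s"
    unfolding backward_limit_def using complete convergent_LIMSEQ_iff by blast
  have "(\<lambda>t. \<kappa> ^ t * dist z z0) \<longlonglongrightarrow> 0"
    using \<kappa> by (intro tendsto_mult_left_zero LIMSEQ_power_zero) simp
  from tendsto_add[OF this iffD1[OF tendsto_dist_iff lim]]
  have "(\<lambda>t. \<kappa> ^ t * dist z z0 + dist (backward_iterate F t s z0) (backward_limit s)) \<longlonglongrightarrow> 0" by simp
  then show ?thesis
  proof (rule metric_tendsto_imp_tendsto, intro always_eventually allI)
    fix t
    have "dist (backward_iterate F t s z) (backward_iterate F t s z0) \<le> \<kappa> ^ t * dist z z0"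
      by (intro backward_iterate_dist_le contr \<kappa>)
    then show "dist (backward_iterate F t s z) (backward_limit s)
        \<le> dist (\<kappa> ^ t * dist z z0 + dist (backward_iterate F t s z0) (backward_limit s)) 0"
      using dist_triangle[of "backward_iterate F t s z" "backward_limit s" "backward_iterate F t s z0"]
      by (simp add: dist_real_def)
  qed
qed

lemma distr_noise_reverse: "distr noise noise (\<lambda>s i. s (reverse_below t i)) = noise"
  using distr_PiM_reindex[of UNIV "\<lambda>_. \<nu>" "reverse_below t" UNIV]
  by (simp add: inj_reverse_below prob_space_axioms restrict_UNIV)

lemma measurable_reverse: "(\<lambda>s i. s (reverse_below t i)) \<in> noise \<rightarrow>\<^sub>M noise"
  by (rule measurable_PiM_single') (auto simp: space_PiM)

lemma measurable_backward_iterate [measurable]: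
  "(\<lambda>s. backward_iterate F t s z) \<in> borel_measurable noise"
  unfolding backward_iterate_eq_forward_iterate
  by (rule measurable_compose[OF measurable_reverse measurable_forward_iterate])

lemma measurable_backward_limit [measurable]: "backward_limit \<in> borel_measurable noise"
  by (rule borel_measurable_LIMSEQ_metric[OF measurable_backward_iterate backward_iterate_tendsto])

text \<open>Reversing finitely many coordinates preserves the product measure.\<close>

lemma forward_backward_same_law:
  "distr noise borel (\<lambda>s. forward_iterate F t s z) = distr noise borel (\<lambda>s. backward_iterate F t s z)"
proof -
  have "distr noise borel (\<lambda>s. forward_iterate F t s z)
      = distr (distr noise noise (\<lambda>s i. s (reverse_below t i))) borel (\<lambda>s. forward_iterate F t s z)"
    by (simp only: distr_noise_reverse)
  also have "\<dots> = distr noise borel (\<lambda>s. backward_iterate F t s z)"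
    by (subst distr_distr[OF measurable_forward_iterate measurable_reverse])
       (simp add: backward_iterate_eq_forward_iterate comp_def)
  finally show ?thesis .
qed

text \<open>Equality in law replaces the forward by the backward iterates, which converge pathwise; then
  dominated convergence applies.\<close>

lemma forward_iterate_expectation_tendsto:
  fixes \<phi> :: "'e \<Rightarrow>\<^sub>C real"
  shows "(\<lambda>t. \<integral>s. \<phi> (forward_iterate F t s z) \<partial>noise) \<longlonglongrightarrow> (\<integral>u. \<phi> u \<partial>invariant_law)"
proof -
  have \<phi>: "apply_bcontfun \<phi> \<in> borel_measurable borel"
    by (intro borel_measurable_continuous_onI) simp
  note [measurable] = \<phi>
  obtain b where b: "\<And>u. \<bar>\<phi> u\<bar> \<le> b"
    using bounded_apply_bcontfun[of \<phi>] by (auto simp: bounded_iff)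
  have "(\<integral>s. \<phi> (forward_iterate F t s z) \<partial>noise) = (\<integral>s. \<phi> (backward_iterate F t s z) \<partial>noise)" for t
    using arg_cong[OF forward_backward_same_law, of "\<lambda>N. integral\<^sup>L N \<phi>" t z]
    by (simp add: integral_distr measurable_forward_iterate)
  moreover have "(\<lambda>t. \<integral>s. \<phi> (backward_iterate F t s z) \<partial>noise) \<longlonglongrightarrow> (\<integral>s. \<phi> (backward_limit s) \<partial>noise)"
  proof (rule integral_dominated_convergence[where w="\<lambda>_. b"])
    show "AE s in noise. (\<lambda>t. \<phi> (backward_iterate F t s z)) \<longlonglongrightarrow> \<phi> (backward_limit s)"
      by (intro AE_I2 continuous_on_tendsto_compose[OF continuous_on_apply_bcontfun[of UNIV]]
          backward_iterate_tendsto) auto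
  qed (auto simp: b)
  ultimately show ?thesis by (simp add: invariant_law_def integral_distr)
qed

lemma measurable_transition: "transition \<in> borel \<rightarrow>\<^sub>M prob_algebra borel"
  unfolding transition_def
proof (rule measurable_distr_prob_space2[where M=\<nu>])
  show "(\<lambda>_. \<nu>) \<in> borel \<rightarrow>\<^sub>M prob_algebra \<nu>"
    by (rule measurable_const) (simp add: space_prob_algebra prob_space_axioms)
qed measurable

text \<open>Putting a fresh map in front of the noise sequence applies that map to the limit. This is the
  pathwise form of stationarity.\<close>

lemma backward_limit_case_nat:
  assumes \<xi>: "\<xi> \<in> space \<nu>" and s: "s \<in> space noise"
  shows "backward_limit (case_nat \<xi> s) = F \<xi> (backward_limit s)"
proof (rule LIMSEQ_unique)
  have s': "case_nat \<xi> s \<in> space noise"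
    using \<xi> noise_space[OF s] by (auto simp: space_PiM split: nat.split)
  show "(\<lambda>t. backward_iterate F (Suc t) (case_nat \<xi> s) z0) \<longlonglongrightarrow> backward_limit (case_nat \<xi> s)"
    by (rule LIMSEQ_Suc[OF backward_iterate_tendsto[OF s']])
  show "(\<lambda>t. backward_iterate F (Suc t) (case_nat \<xi> s) z0) \<longlonglongrightarrow> F \<xi> (backward_limit s)"
    using continuous_on_tendsto_compose[OF contraction_continuous[OF \<xi>] backward_iterate_tendsto[OF s]]
    by simp
qed

text \<open>A fresh \<open>\<xi>\<close> put in front of an i.i.d. sequence gives again an i.i.d. sequence. By the previous
  lemma, one step of the chain started from the law of the limit therefore reproduces that law.\<close>

lemma stationary_invariant_law: "stationary_distribution borel transition invariant_law"
proof -
  have prob: "invariant_law \<in> space (prob_algebra borel)"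
    by (auto simp: invariant_law_def space_prob_algebra intro!: S.prob_space_distr)
  have "bind invariant_law transition = invariant_law"
  proof (rule measure_eqI)
    have k: "transition \<in> invariant_law \<rightarrow>\<^sub>M prob_algebra borel"
      using measurable_transition by (simp add: invariant_law_def)
    note k' = measurable_prob_algebraD[OF k]
    show sets: "sets (bind invariant_law transition) = sets invariant_law"
      by (subst sets_bind[of _ _ borel]) (auto simp: invariant_law_def transition_def)
    fix A assume "A \<in> sets (bind invariant_law transition)"
    then have A [measurable]: "A \<in> sets borel" unfolding sets by (simp add: invariant_law_def)
    have "emeasure (bind invariant_law transition) A = (\<integral>\<^sup>+ z. emeasure (transition z) A \<partial>invariant_law)"
      by (rule emeasure_bind[OF _ k' A]) (simp add: invariant_law_def)
    also have "\<dots> = (\<integral>\<^sup>+ s. emeasure (transition (backward_limit s)) A \<partial>noise)"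
      unfolding invariant_law_def
      using measurable_prob_algebraD[OF measurable_transition]
      by (intro nn_integral_distr) measurable
    also have "\<dots> = (\<integral>\<^sup>+ s. (\<integral>\<^sup>+ \<xi>. indicator A (F \<xi> (backward_limit s)) \<partial>\<nu>) \<partial>noise)"
    proof (rule nn_integral_cong)
      fix s
      have "(\<lambda>\<xi>. F \<xi> (backward_limit s)) \<in> borel_measurable \<nu>" by measurable
      then show "emeasure (transition (backward_limit s)) A = (\<integral>\<^sup>+ \<xi>. indicator A (F \<xi> (backward_limit s)) \<partial>\<nu>)"
        by (simp add: transition_def nn_integral_distr flip: nn_integral_indicator)
    qed
    also have "\<dots> = (\<integral>\<^sup>+ p. indicator A (F (fst p) (backward_limit (snd p))) \<partial>(\<nu> \<Otimes>\<^sub>M noise))"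
    proof -
      interpret P: pair_sigma_finite \<nu> noise ..
      show ?thesis
        by (subst P.nn_integral_snd[symmetric]) (auto simp: case_prod_beta)
    qed
    also have "\<dots> = (\<integral>\<^sup>+ p. indicator A (backward_limit (case_nat (fst p) (snd p))) \<partial>(\<nu> \<Otimes>\<^sub>M noise))"
      by (rule nn_integral_cong) (simp add: backward_limit_case_nat space_pair_measure mem_Times_iff)
    also have "\<dots> = (\<integral>\<^sup>+ s. indicator A (backward_limit s) \<partial>distr (\<nu> \<Otimes>\<^sub>M noise) noise (\<lambda>(\<xi>, s). case_nat \<xi> s))"
      by (subst nn_integral_distr) (auto simp: case_prod_beta)
    also have "\<dots> = (\<integral>\<^sup>+ s. indicator A (backward_limit s) \<partial>noise)"
      by (simp only: S.PiM_iter)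
    also have "\<dots> = emeasure invariant_law A"
      by (simp add: invariant_law_def nn_integral_distr flip: nn_integral_indicator)
    finally show "emeasure (bind invariant_law transition) A = emeasure invariant_law A" .
  qed
  with prob show ?thesis by (simp add: stationary_distribution_def)
qed

end

lemma subalgebra_history:
  assumes "\<And>s. s \<le> t \<Longrightarrow> Y s \<in> M \<rightarrow>\<^sub>M S"
  shows "subalgebra M (history M S Y t)"
proof -
  have "(\<lambda>\<omega>. \<lambda>s\<in>{..t}. Y s \<omega>) \<in> M \<rightarrow>\<^sub>M (\<Pi>\<^sub>M s\<in>{..t}. S)"
    using assms by (intro measurable_restrict) auto
  then have "sets (history M S Y t) \<subseteq> sets M"
    unfolding history_def by (subst sets_vimage_algebra2) (auto dest: measurable_space measurable_sets)
  then show ?thesis by (simp add: subalgebra_def history_def)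
qed

lemma measurable_history:
  assumes Y: "\<And>s \<omega>. s \<le> t \<Longrightarrow> \<omega> \<in> space M \<Longrightarrow> Y s \<omega> \<in> space S" and s: "s \<le> t"
  shows "Y s \<in> history M S Y t \<rightarrow>\<^sub>M S"
proof -
  have "(\<lambda>\<omega>. \<lambda>s\<in>{..t}. Y s \<omega>) \<in> history M S Y t \<rightarrow>\<^sub>M (\<Pi>\<^sub>M s\<in>{..t}. S)"
    unfolding history_def using Y by (intro measurable_vimage_algebra1) (auto simp: space_PiM)
  from measurable_compose[OF this measurable_component_singleton[of s]] s
  show ?thesis by simp
qed

locale random_contraction_chain = random_contraction \<nu> F \<kappa> B z0 + M: prob_space M
  for \<nu> :: "'n measure" and F :: "'n \<Rightarrow> 'e::metric_space \<Rightarrow> 'e" and \<kappa> B z0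
    and M :: "'w measure" +
  fixes \<xi> :: "nat \<Rightarrow> 'w \<Rightarrow> 'n" and z :: 'e
  assumes indep: "M.indep_vars (\<lambda>_. \<nu>) \<xi> UNIV"
    and law: "\<And>t. distr M \<nu> (\<xi> t) = \<nu>"
begin

abbreviation Z :: "nat \<Rightarrow> 'w \<Rightarrow> 'e" where
  "Z t \<omega> \<equiv> forward_iterate F t (\<lambda>i. \<xi> i \<omega>) z"

lemma measurable_\<xi> [measurable]: "\<xi> t \<in> M \<rightarrow>\<^sub>M \<nu>"
  using indep unfolding M.indep_vars_def2 by blast

lemma distr_noise: "distr M noise (\<lambda>\<omega> i. \<xi> i \<omega>) = noise"
  using M.indep_vars_iff_distr_eq_PiM[OF UNIV_not_empty, of \<xi> "\<lambda>_. \<nu>"] measurable_\<xi> indep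
  unfolding law restrict_UNIV by blast

lemma measurable_chain_history: "Z t \<in> history M \<nu> \<xi> t \<rightarrow>\<^sub>M borel"
proof -
  have "Z k \<in> history M \<nu> \<xi> t \<rightarrow>\<^sub>M borel" if "k \<le> t" for k
    using that
  proof (induction k)
    case (Suc k)
    have "\<xi> k \<in> history M \<nu> \<xi> t \<rightarrow>\<^sub>M \<nu>"
      using Suc.prems by (intro measurable_history) (simp_all add: measurable_space[OF measurable_\<xi>])
    moreover have "Z k \<in> history M \<nu> \<xi> t \<rightarrow>\<^sub>M borel" using Suc by simp
    ultimately show ?case
      unfolding forward_iterate.simps by (rule measurable_F_compose)
  qed simp
  from this[OF order_refl] show ?thesis .
qed

lemma measurable_chain [measurable]: "Z t \<in> borel_measurable M"
proof (induction t)
  case (Suc t)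
  then show ?case
    unfolding forward_iterate.simps by (rule measurable_F_compose[OF measurable_\<xi>])
qed simp

lemma converges_in_law_chain: "converges_in_law M Z invariant_law"
  unfolding converges_in_law_def
proof
  fix \<phi> :: "'e \<Rightarrow>\<^sub>C real"
  have [measurable]: "apply_bcontfun \<phi> \<in> borel_measurable borel"
    by (intro borel_measurable_continuous_onI) simp
  have \<xi>: "(\<lambda>\<omega> i. \<xi> i \<omega>) \<in> M \<rightarrow>\<^sub>M noise"
  proof (rule measurable_PiM_single'[OF measurable_\<xi>])
    show "(\<lambda>\<omega> i. \<xi> i \<omega>) \<in> space M \<rightarrow> (\<Pi>\<^sub>E i\<in>UNIV. space \<nu>)"
      by (rule funcsetI, rule PiE_I) (erule measurable_space[OF measurable_\<xi>], blast)
  qed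
  have "(\<integral>s. \<phi> (forward_iterate F t s z) \<partial>noise) = (\<integral>u. \<phi> u \<partial>distr M borel (Z t))" for t
  proof -
    have "(\<integral>s. \<phi> (forward_iterate F t s z) \<partial>noise)
        = (\<integral>s. \<phi> (forward_iterate F t s z) \<partial>distr M noise (\<lambda>\<omega> i. \<xi> i \<omega>))"
      by (simp only: distr_noise)
    also have "\<dots> = (\<integral>\<omega>. \<phi> (Z t \<omega>) \<partial>M)"
      by (rule integral_distr[OF \<xi> measurable_compose[OF measurable_forward_iterate]]) fact
    also have "\<dots> = (\<integral>u. \<phi> u \<partial>distr M borel (Z t))"
      by (rule integral_distr[symmetric, OF measurable_chain]) fact
    finally show ?thesis .
  qed
  with forward_iterate_expectation_tendsto[of \<phi> z]
  show "(\<lambda>t. \<integral>u. \<phi> u \<partial>distr M borel (Z t)) \<longlonglongrightarrow> (\<integral>u. \<phi> u \<partial>invariant_law)" by simp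
qed

text \<open>The noise at time \<open>t\<close> is independent of the noise before it. The notion of independence of two
  variables in use requires a common value type, hence the detour through the product over the
  singleton \<open>{t}\<close>.\<close>

lemma distr_past_present:
  "distr M ((\<Pi>\<^sub>M i\<in>{..<t}. \<nu>) \<Otimes>\<^sub>M \<nu>) (\<lambda>\<omega>. (\<lambda>i\<in>{..<t}. \<xi> i \<omega>, \<xi> t \<omega>))
     = distr M (\<Pi>\<^sub>M i\<in>{..<t}. \<nu>) (\<lambda>\<omega>. \<lambda>i\<in>{..<t}. \<xi> i \<omega>) \<Otimes>\<^sub>M \<nu>"
proof -
  let ?P = "\<Pi>\<^sub>M i\<in>{..<t}. \<nu>" and ?Q = "\<Pi>\<^sub>M i\<in>{t}. \<nu>"
  let ?past = "\<lambda>\<omega>. \<lambda>i\<in>{..<t}. \<xi> i \<omega>" and ?now = "\<lambda>\<omega>. \<lambda>i\<in>{t}. \<xi> i \<omega>"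
  have "M.indep_var (\<Pi>\<^sub>M i\<in>{..<t}. \<nu>) (\<lambda>\<omega>. \<lambda>i\<in>{..<t}. \<xi> i \<omega>) (\<Pi>\<^sub>M i\<in>{t}. \<nu>) (\<lambda>\<omega>. \<lambda>i\<in>{t}. \<xi> i \<omega>)"
    by (rule M.indep_var_restrict[OF indep]) auto
  then have eq: "distr M ?P ?past \<Otimes>\<^sub>M distr M ?Q ?now = distr M (?P \<Otimes>\<^sub>M ?Q) (\<lambda>\<omega>. (?past \<omega>, ?now \<omega>))"
    and past: "?past \<in> M \<rightarrow>\<^sub>M ?P" and now: "?now \<in> M \<rightarrow>\<^sub>M ?Q"
    by (simp_all only: M.indep_var_distribution_eq)
  have ev: "(\<lambda>w. w t) \<in> ?Q \<rightarrow>\<^sub>M \<nu>" by (rule measurable_component_singleton) simp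
  have "distr (distr M ?Q ?now) \<nu> (\<lambda>w. w t) = \<nu>"
    by (subst distr_distr[OF ev now]) (simp add: comp_def law)
  then have "distr M ?P ?past \<Otimes>\<^sub>M \<nu>
      = distr (distr M ?P ?past) ?P (\<lambda>w. w) \<Otimes>\<^sub>M distr (distr M ?Q ?now) \<nu> (\<lambda>w. w t)"
    by (simp add: distr_id2)
  also have "\<dots> = distr (distr M ?P ?past \<Otimes>\<^sub>M distr M ?Q ?now) (?P \<Otimes>\<^sub>M \<nu>) (\<lambda>(w, v). (w, v t))"
  proof (rule pair_measure_distr)
    show "sigma_finite_measure (distr (distr M ?Q ?now) \<nu> (\<lambda>w. w t))"
      unfolding \<open>distr (distr M ?Q ?now) \<nu> (\<lambda>w. w t) = \<nu>\<close> by unfold_locales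
  qed (use ev in simp_all)
  also have "\<dots> = distr M (?P \<Otimes>\<^sub>M \<nu>) (\<lambda>\<omega>. (?past \<omega>, \<xi> t \<omega>))"
    unfolding eq
    by (subst distr_distr) (use ev past now in \<open>auto simp: comp_def case_prod_beta\<close>)
  finally show ?thesis by (rule sym)
qed

text \<open>Events of the history of the chain up to time \<open>t\<close> are functions of the noise before \<open>t\<close>. By
  independence, Fubini's theorem integrates out the noise at time \<open>t\<close> first, which leaves the
  transition kernel evaluated at the present state.\<close>

lemma homogeneous_markov_chain_chain: "homogeneous_markov_chain M borel transition Z"
  unfolding homogeneous_markov_chain_def
proof (intro conjI allI ballI measurable_transition measurable_chain)
  fix t and A :: "'e set" assume A [measurable]: "A \<in> sets borel"
  let ?H = "history M borel Z t"
  let ?P = "\<Pi>\<^sub>M i\<in>{..<t}. \<nu>"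
  let ?past = "\<lambda>\<omega>. \<lambda>i\<in>{..<t}. \<xi> i \<omega>"
  let ?G = "\<lambda>k w. forward_iterate F k w z"
  note sub_transition = measurable_prob_algebraD[OF measurable_transition]
  have sub: "subalgebra M ?H" by (rule subalgebra_history) simp
  interpret H: finite_measure_subalgebra M ?H by unfold_locales (rule sub)
  have measA [measurable]: "(\<lambda>u. measure (transition u) A) \<in> borel_measurable borel"
    by (rule measurable_compose[OF sub_transition measurable_measure_subprob_algebra]) measurable
  have past [measurable]: "?past \<in> M \<rightarrow>\<^sub>M ?P" by measurable
  have G: "Z k \<omega> = ?G k (?past \<omega>)" if "k \<le> t" for k \<omega>
    using that by (intro forward_iterate_cong) auto
  have measG [measurable]: "?G k \<in> borel_measurable ?P" if "k \<le> t" for k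
    using that by (induction k) simp_all
  interpret P: prob_space "distr M ?P ?past" by (rule M.prob_space_distr) measurable
  interpret PP: pair_prob_space "distr M ?P ?past" \<nu> ..
  show "AE \<omega> in M. real_cond_exp M ?H (\<lambda>\<omega>. indicator A (Z (Suc t) \<omega>)) \<omega> = measure (transition (Z t \<omega>)) A"
  proof (rule H.real_cond_exp_charact)
    fix U assume "U \<in> sets ?H"
    then obtain D where D [measurable]: "D \<in> sets (\<Pi>\<^sub>M s\<in>{..t}. borel)"
      and U: "U = (\<lambda>\<omega>. \<lambda>s\<in>{..t}. Z s \<omega>) -` D \<inter> space M"
      unfolding history_def by (auto simp: sets_vimage_algebra2 space_PiM)
    \<comment> \<open>The whole history of the chain as a function of the past noise.\<close>
    define h where "h w = (\<lambda>s\<in>{..t}. ?G s w)" for w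
    have h [measurable]: "h \<in> ?P \<rightarrow>\<^sub>M (\<Pi>\<^sub>M s\<in>{..t}. borel)"
      unfolding h_def by (intro measurable_restrict measG) simp
    have indU: "indicator U \<omega> = (indicator D (h (?past \<omega>)) :: real)" if "\<omega> \<in> space M" for \<omega>
    proof -
      have "(\<lambda>s\<in>{..t}. Z s \<omega>) = h (?past \<omega>)"
        unfolding h_def by (rule restrict_ext) (rule G, simp)
      with that show ?thesis by (simp add: U indicator_def)
    qed
    define f where "f w e = (indicator D (h w) * indicator A (F e (?G t w)) :: real)" for w e
    have [measurable]: "(\<lambda>(w, e). f w e) \<in> borel_measurable (?P \<Otimes>\<^sub>M \<nu>)"
    proof -
      have [measurable]: "?G t \<in> borel_measurable ?P" by (rule measG) simp
      show ?thesis unfolding f_def by measurable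
    qed
    have "(\<integral>\<omega>\<in>U. indicator A (Z (Suc t) \<omega>) \<partial>M) = (\<integral>\<omega>. (\<lambda>(w, e). f w e) (?past \<omega>, \<xi> t \<omega>) \<partial>M)"
      unfolding set_lebesgue_integral_def
      by (rule Bochner_Integration.integral_cong) (simp_all add: indU f_def G[of t])
    also have "\<dots> = (\<integral>p. (\<lambda>(w, e). f w e) p \<partial>(distr M ?P ?past \<Otimes>\<^sub>M \<nu>))"
      by (subst distr_past_present[symmetric], subst integral_distr) auto
    also have "\<dots> = (\<integral>w. (\<integral>e. f w e \<partial>\<nu>) \<partial>distr M ?P ?past)"
    proof (subst PP.integral_fst'[symmetric])
      show "integrable (distr M ?P ?past \<Otimes>\<^sub>M \<nu>) (\<lambda>(w, e). f w e)"
        by (rule PP.P.integrable_const_bound[of _ 1])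
           (auto simp: f_def indicator_def)
    qed simp
    also have "\<dots> = (\<integral>\<omega>. (\<integral>e. f (?past \<omega>) e \<partial>\<nu>) \<partial>M)"
      by (rule integral_distr) measurable
    also have "\<dots> = (\<integral>\<omega>\<in>U. measure (transition (Z t \<omega>)) A \<partial>M)"
      unfolding set_lebesgue_integral_def
    proof (rule Bochner_Integration.integral_cong)
      fix \<omega> assume \<omega>: "\<omega> \<in> space M"
      let ?u = "Z t \<omega>"
      have "measure (transition ?u) A = (\<integral>v. indicator A v \<partial>transition ?u)"
        by (simp add: transition_def)
      also have "\<dots> = (\<integral>e. indicator A (F e ?u) \<partial>\<nu>)"
        unfolding transition_def by (rule integral_distr) measurable
      finally show "(\<integral>e. f (?past \<omega>) e \<partial>\<nu>) = indicator U \<omega> *\<^sub>R measure (transition ?u) A"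
        by (simp add: f_def indU[OF \<omega>] G[of t])
    qed simp
    finally show "(\<integral>\<omega>\<in>U. indicator A (Z (Suc t) \<omega>) \<partial>M) = (\<integral>\<omega>\<in>U. measure (transition (Z t \<omega>)) A \<partial>M)" .
  next
    show "integrable M (\<lambda>\<omega>. indicator A (Z (Suc t) \<omega>) :: real)"
      by (rule M.integrable_const_bound[of _ 1]) (auto simp: indicator_def simp del: forward_iterate.simps)
    show "integrable M (\<lambda>\<omega>. measure (transition (Z t \<omega>)) A)"
    proof (rule M.integrable_const_bound[of _ 1])
      show "(\<lambda>\<omega>. measure (transition (Z t \<omega>)) A) \<in> borel_measurable M"
        by (rule measurable_compose[OF measurable_chain measA])
    qed (auto simp: transition_def intro!: prob_space.prob_le_1 prob_space_distr)
    have "Z t \<in> ?H \<rightarrow>\<^sub>M borel" by (rule measurable_history) auto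
    then show "(\<lambda>\<omega>. measure (transition (Z t \<omega>)) A) \<in> borel_measurable ?H"
      by (rule measurable_compose[OF _ measA])
  qed
qed

end

section \<open>Separability and measurability\<close>

lemma compact_UNIV_finite_nets:
  assumes "compact (UNIV :: 'a::metric_space set)"
  shows "\<exists>net :: nat \<Rightarrow> 'a set. \<forall>m. finite (net m) \<and> (\<forall>x. \<exists>d\<in>net m. dist d x < 1 / real (Suc m))"
proof (intro choice allI)
  fix m
  have "1 / real (Suc m) > 0" by simp
  with assms obtain N :: "'a set" where "finite N" "UNIV \<subseteq> (\<Union>d\<in>N. ball d (1 / real (Suc m)))"
    unfolding compact_eq_totally_bounded by blast
  then show "\<exists>N :: 'a set. finite N \<and> (\<forall>x. \<exists>d\<in>N. dist d x < 1 / real (Suc m))"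
    by (intro exI[of _ N]) (force simp del: of_nat_Suc)
qed

lemma compact_UNIV_imp_separable:
  assumes "compact (UNIV :: 'a::metric_space set)"
  obtains D :: "'a::metric_space set" where "countable D" "closure D = UNIV"
proof -
  obtain net :: "nat \<Rightarrow> 'a set" where
    net: "\<And>m. finite (net m)" "\<And>m x. \<exists>d\<in>net m. dist d x < 1 / real (Suc m)"
    using compact_UNIV_finite_nets[OF assms] by blast
  have "x \<in> closure (\<Union>m. net m)" for x
    unfolding closure_approachable
  proof (intro allI impI)
    fix e :: real assume "e > 0"
    then obtain m where m: "1 / real (Suc m) < e" using nat_approx_posE by metis
    with net(2)[of m x] show "\<exists>d\<in>\<Union>m. net m. dist d x < e" by force
  qed
  then show thesis
    using net(1) by (intro that[of "\<Union>m. net m"]) (auto intro: countable_finite)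
qed

text \<open>A continuous function is determined up to \<open>3 / Suc k\<close> by its modulus of continuity at one scale
  and by its values, rounded to multiples of \<open>1 / Suc k\<close>, on a finite net of that scale. There are
  countably many such data, and one representative of each forms a dense set.\<close>

lemma separable_bcontfun:
  assumes compact: "compact (UNIV :: 'a::metric_space set)"
  obtains D :: "('a::metric_space \<Rightarrow>\<^sub>C real) set" where "countable D" "closure D = UNIV"
proof -
  obtain net :: "nat \<Rightarrow> 'a set" where
    net: "\<And>m. finite (net m)" "\<And>m x. \<exists>d\<in>net m. dist d x < 1 / real (Suc m)"
    using compact_UNIV_finite_nets[OF compact] by blast
  define modulus where "modulus m k f \<longleftrightarrow>
    (\<forall>u v. dist u v < 1 / real (Suc m) \<longrightarrow> \<bar>f u - f v\<bar> < 1 / real (Suc k))"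
    for m k :: nat and f :: "'a \<Rightarrow>\<^sub>C real"
  define code where "code m k f = (\<lambda>d. (d, \<lfloor>real (Suc k) * f d\<rfloor>)) ` net m"
    for m k :: nat and f :: "'a \<Rightarrow>\<^sub>C real"
  define codes where "codes = {c. finite c \<and> c \<subseteq> (\<Union>m. net m) \<times> (UNIV :: int set)}"
  have "countable ((\<Union>m. net m) \<times> (UNIV :: int set))"
    using net(1) by (intro countable_SIGMA countable_UN) (auto intro: countable_finite)
  then have "countable codes"
    unfolding codes_def by (rule countable_Collect_finite_subset)
  have code_in: "code m k f \<in> codes" for m k f
    unfolding code_def codes_def using net(1) by auto
  define rep where "rep m k c = (SOME f. modulus m k f \<and> code m k f = c)" for m k c
  define D where "D = (\<lambda>(m, k, c). rep m k c) ` (UNIV \<times> UNIV \<times> codes)"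
  have "countable D"
    unfolding D_def using \<open>countable codes\<close> by (intro countable_image countable_SIGMA) auto
  moreover have "f \<in> closure D" for f
    unfolding closure_approachable
  proof (intro allI impI)
    fix e :: real assume e: "e > 0"
    then obtain k where k: "1 / real (Suc k) < e / 3" using nat_approx_posE[of "e / 3"] by auto
    have "uniformly_continuous_on UNIV (apply_bcontfun f)"
      by (rule compact_uniformly_continuous[OF _ compact]) simp
    then obtain \<delta> where \<delta>: "\<delta> > 0" "\<And>u v. dist u v < \<delta> \<Longrightarrow> \<bar>f u - f v\<bar> < 1 / real (Suc k)"
      unfolding uniformly_continuous_on_def dist_real_def
      by (metis UNIV_I dist_commute of_nat_0_less_iff zero_less_Suc zero_less_divide_1_iff)
    from \<delta>(1) obtain m where m: "1 / real (Suc m) < \<delta>" using nat_approx_posE by metis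
    have f: "modulus m k f" unfolding modulus_def using \<delta>(2) m by (meson less_trans)
    define g where "g = rep m k (code m k f)"
    have "modulus m k g \<and> code m k g = code m k f"
      unfolding g_def rep_def by (rule someI[of _ f]) (simp add: f)
    then have g: "modulus m k g" and eq: "code m k g = code m k f" by auto
    have "dist (g x) (f x) \<le> 3 / real (Suc k)" for x
    proof -
      obtain d where d: "d \<in> net m" "dist d x < 1 / real (Suc m)" using net(2)[of m x] by blast
      have "(d, \<lfloor>real (Suc k) * g d\<rfloor>) \<in> code m k f" using d(1) eq by (auto simp: code_def)
      then have "\<lfloor>real (Suc k) * g d\<rfloor> = \<lfloor>real (Suc k) * f d\<rfloor>" by (auto simp: code_def)
      then have "\<bar>real (Suc k) * g d - real (Suc k) * f d\<bar> < 1" by linarith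
      also have "real (Suc k) * g d - real (Suc k) * f d = real (Suc k) * (g d - f d)"
        by (simp add: algebra_simps)
      finally have "real (Suc k) * \<bar>g d - f d\<bar> < 1" by (simp add: abs_mult)
      then have "\<bar>g d - f d\<bar> < 1 / real (Suc k)"
        by (simp add: field_simps del: of_nat_Suc)
      moreover have "\<bar>g d - g x\<bar> < 1 / real (Suc k)" "\<bar>f d - f x\<bar> < 1 / real (Suc k)"
        using f g d(2) unfolding modulus_def by blast+
      ultimately show ?thesis unfolding dist_real_def by linarith
    qed
    then have "dist g f \<le> 3 / real (Suc k)" by (rule dist_bound)
    also have "\<dots> < e" using k by simp
    finally have "dist g f < e" .
    moreover have "(m, k, code m k f) \<in> UNIV \<times> UNIV \<times> codes" using code_in by simp
    from imageI[OF this, of "\<lambda>(m, k, c). rep m k c"] have "g \<in> D" by (simp add: D_def g_def)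
    ultimately show "\<exists>g\<in>D. dist g f < e" by blast
  qed
  ultimately show thesis by (intro that) auto
qed

text \<open>In a separable metric space every open set is a countable union of balls. The separability is a
  hypothesis on the space, since compactness of \<open>UNIV\<close> does not make the type an instance of the
  class of second countable spaces.\<close>

lemma borel_measurable_if_dist_measurable:
  fixes f :: "'m \<Rightarrow> 'b::metric_space"
  assumes D: "countable D" "closure D = UNIV"
    and dist: "\<And>d. d \<in> D \<Longrightarrow> (\<lambda>w. dist (f w) d) \<in> borel_measurable N"
  shows "f \<in> borel_measurable N"
proof (rule borel_measurableI)
  fix U :: "'b set" assume "open U"
  define I where "I = {(d, q). d \<in> D \<and> q \<in> \<rat> \<and> ball d q \<subseteq> U}"
  have "I \<subseteq> D \<times> \<rat>" by (auto simp: I_def)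
  then have "countable I"
    by (rule countable_subset) (intro countable_SIGMA D countable_rat)
  have "f -` U \<inter> space N = (\<Union>(d, q)\<in>I. {w \<in> space N. dist (f w) d < q})"
  proof (intro equalityI subsetI)
    fix w assume w: "w \<in> f -` U \<inter> space N"
    with \<open>open U\<close> obtain e where e: "e > 0" "ball (f w) e \<subseteq> U"
      by (auto simp: open_contains_ball)
    have "f w \<in> closure D" using D by simp
    then obtain d where d: "d \<in> D" "dist d (f w) < e / 3"
      using e(1) unfolding closure_approachable by (meson divide_pos_pos zero_less_numeral)
    obtain q where q: "q \<in> \<rat>" "e / 3 < q" "q < e / 2"
      using Rats_dense_in_real[of "e / 3" "e / 2"] e(1) by auto
    have "ball d q \<subseteq> ball (f w) e"
    proof
      fix u assume "u \<in> ball d q"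
      then show "u \<in> ball (f w) e"
        using dist_triangle[of "f w" u d] d(2) q e(1) by (simp add: dist_commute)
    qed
    with e(2) d(1) q(1) have "(d, q) \<in> I" by (auto simp: I_def)
    moreover have "dist (f w) d < q" using d(2) q(2) by (simp add: dist_commute)
    ultimately show "w \<in> (\<Union>(d, q)\<in>I. {w \<in> space N. dist (f w) d < q})"
      using w by blast
  next
    fix w assume "w \<in> (\<Union>(d, q)\<in>I. {w \<in> space N. dist (f w) d < q})"
    then show "w \<in> f -` U \<inter> space N"
      by (auto simp: I_def dist_commute)
  qed
  also have "\<dots> \<in> sets N"
  proof (intro sets.countable_UN'' \<open>countable I\<close>)
    fix i assume "i \<in> I"
    then obtain d q where i: "i = (d, q)" "d \<in> D" by (auto simp: I_def)
    note [measurable] = dist[OF i(2)]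
    show "(case i of (d, q) \<Rightarrow> {w \<in> space N. dist (f w) d < q}) \<in> sets N"
      unfolding i(1) by simp
  qed
  finally show "f -` U \<inter> space N \<in> sets N" .
qed

lemma borel_measurable_Pair_separable:
  fixes f :: "'m \<Rightarrow> 'b::metric_space" and g :: "'m \<Rightarrow> 'c::metric_space"
    and D :: "'b set" and E :: "'c set"
  assumes D: "countable D" "closure D = UNIV" and E: "countable E" "closure E = UNIV"
    and f [measurable]: "f \<in> borel_measurable N" and g [measurable]: "g \<in> borel_measurable N"
  shows "(\<lambda>w. (f w, g w)) \<in> borel_measurable N"
proof (rule borel_measurable_if_dist_measurable)
  show "countable (D \<times> E)" using D E by auto
  show "closure (D \<times> E) = UNIV" by (simp add: closure_Times D E)
  fix d assume "d \<in> D \<times> E"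
  have "(\<lambda>w. dist (f w) (fst d)) \<in> borel_measurable N"
    by (rule measurable_compose[OF f borel_measurable_continuous_onI]) (intro continuous_intros)
  moreover have "(\<lambda>w. dist (g w) (snd d)) \<in> borel_measurable N"
    by (rule measurable_compose[OF g borel_measurable_continuous_onI]) (intro continuous_intros)
  ultimately show "(\<lambda>w. dist (f w, g w) d) \<in> borel_measurable N"
    by (simp add: dist_prod_def)
qed

text \<open>The sup-distance to a fixed function can be computed on a countable dense set of points.\<close>

lemma borel_measurable_bcontfun_pointwise:
  fixes f :: "'m \<Rightarrow> ('a::metric_space \<Rightarrow>\<^sub>C real)"
  assumes compact: "compact (UNIV :: 'a set)"
    and f: "\<And>u. (\<lambda>w. f w u) \<in> borel_measurable N"
  shows "f \<in> borel_measurable N"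
proof -
  obtain A :: "'a set" where A: "countable A" "closure A = UNIV"
    by (rule compact_UNIV_imp_separable[OF compact])
  obtain D :: "('a \<Rightarrow>\<^sub>C real) set" where D: "countable D" "closure D = UNIV"
    by (rule separable_bcontfun[OF compact])
  note [measurable] = f
  show ?thesis
  proof (rule borel_measurable_if_dist_measurable[OF D])
    fix d :: "'a \<Rightarrow>\<^sub>C real"
    have le_iff: "dist (f w) d \<le> r \<longleftrightarrow> (\<forall>u\<in>A. \<bar>f w u - d u\<bar> \<le> r)" for w r
    proof
      assume "dist (f w) d \<le> r"
      then show "\<forall>u\<in>A. \<bar>f w u - d u\<bar> \<le> r"
        using dist_bounded[of "f w" _ d] unfolding dist_real_def by (meson order_trans)
    next
      assume *: "\<forall>u\<in>A. \<bar>f w u - d u\<bar> \<le> r"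
      have "\<bar>f w u - d u\<bar> \<le> r" if "u \<in> closure A" for u
        by (rule continuous_le_on_closure[OF _ that])
           (use * in \<open>auto intro!: continuous_intros\<close>)
      then show "dist (f w) d \<le> r"
        using A(2) by (intro dist_bound) (simp add: dist_real_def)
    qed
    have "{w \<in> space N. dist (f w) d \<le> r} \<in> sets N" for r
    proof -
      have "{w \<in> space N. \<forall>u\<in>A. \<bar>f w u - d u\<bar> \<le> r} \<in> sets N"
        by (rule sets.sets_Collect_countable_All'[OF _ A(1)]) measurable
      then show ?thesis by (simp add: le_iff)
    qed
    then show "(\<lambda>w. dist (f w) d) \<in> borel_measurable N"
      by (simp add: borel_measurable_iff_le)
  qed
qed

text \<open>A function that is measurable in one and continuous in the other variable is jointly measurable:
  it is the pointwise limit of functions that round the second variable to a point of the dense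
  set. The index \<open>j k u\<close> below selects the first point within distance \<open>1 / Suc k\<close> of \<open>u\<close>.\<close>

lemma borel_measurable_caratheodory:
  fixes g :: "'m \<Rightarrow> 'a::metric_space \<Rightarrow> real" and A :: "'a set"
  assumes A: "countable A" "closure A = UNIV"
    and meas: "\<And>u. (\<lambda>w. g w u) \<in> borel_measurable N"
    and cont: "\<And>w. w \<in> space N \<Longrightarrow> continuous_on UNIV (g w)"
  shows "(\<lambda>(w, u). g w u) \<in> borel_measurable (N \<Otimes>\<^sub>M borel)"
proof -
  have "A \<noteq> {}" using A(2) by auto
  define a where "a = from_nat_into A"
  have range_a: "range a = A" unfolding a_def by (rule range_from_nat_into) fact+
  define j where "j k u = (LEAST i. dist u (a i) < 1 / real (Suc k))" for k :: nat and u
  have [measurable]: "(\<lambda>u. dist u (a i)) \<in> borel_measurable borel" for i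
    by (intro borel_measurable_continuous_onI continuous_intros)
  have [measurable]: "j k \<in> borel \<rightarrow>\<^sub>M count_space UNIV" for k
    unfolding j_def by measurable
  have j: "dist u (a (j k u)) < 1 / real (Suc k)" for k u
  proof -
    have "u \<in> closure A" using A by simp
    then obtain i where "dist (a i) u < 1 / real (Suc k)"
      unfolding closure_approachable range_a[symmetric]
      by (metis imageE of_nat_0_less_iff zero_less_Suc zero_less_divide_1_iff)
    then show ?thesis unfolding j_def by (intro LeastI) (simp add: dist_commute)
  qed
  have j_tendsto: "(\<lambda>k. a (j k u)) \<longlonglongrightarrow> u" for u
  proof (rule metric_tendsto_imp_tendsto)
    show "(\<lambda>k. 1 / real (Suc k)) \<longlonglongrightarrow> 0" by (rule LIMSEQ_Suc[OF lim_1_over_n])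
    show "\<forall>\<^sub>F k in sequentially. dist (a (j k u)) u \<le> dist (1 / real (Suc k)) 0"
      using j[of u] by (intro always_eventually) (simp add: dist_commute less_imp_le)
  qed
  have "(\<lambda>p. g (fst p) (a (j k (snd p)))) \<in> borel_measurable (N \<Otimes>\<^sub>M borel)" for k
    by (rule measurable_compose_countable[where f="\<lambda>i p. g (fst p) (a i)"])
       (auto intro: measurable_compose[OF measurable_fst meas])
  then show ?thesis
  proof (rule borel_measurable_LIMSEQ_metric)
    fix p :: "'m \<times> 'a" assume "p \<in> space (N \<Otimes>\<^sub>M borel)"
    then have "fst p \<in> space N" by (auto simp: space_pair_measure)
    from continuous_on_tendsto_compose[OF cont[OF this] j_tendsto]
    show "(\<lambda>k. g (fst p) (a (j k (snd p)))) \<longlonglongrightarrow> (case p of (w, u) \<Rightarrow> g w u)"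
      by (simp add: case_prod_beta)
  qed
qed

section \<open>Representatives of potentials\<close>

text \<open>The representative that vanishes at one fixed point. It embeds the potentials into C(X)
  without increasing distances, so that completeness and measurability of potentials reduce to
  those of continuous functions.\<close>

lift_definition pinned :: "'a::topological_space potential \<Rightarrow> ('a \<Rightarrow>\<^sub>C real)"
  is "(\<lambda>f. f - const_bcontfun (apply_bcontfun f undefined))
    :: ('a::topological_space \<Rightarrow>\<^sub>C real) \<Rightarrow> ('a \<Rightarrow>\<^sub>C real)"
  unfolding equal_mod_const_def by (intro bcontfun_eqI) (auto simp: const_bcontfun.rep_eq)

lemma pinned_abs: "pinned (abs_potential f) u = f u - f undefined"
  by (simp add: pinned.abs_eq const_bcontfun.rep_eq)

lemma abs_potential_eq_iff: "abs_potential f = abs_potential g \<longleftrightarrow> (\<exists>c. \<forall>u. f u = g u + c)"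
  by (simp add: potential.abs_eq_iff equal_mod_const_def)

lemma abs_pinned: "abs_potential (pinned p) = p"
proof -
  have p: "p = abs_potential (rep_potential p)"
    by (simp add: Quotient3_abs_rep[OF Quotient3_potential])
  show ?thesis
    by (subst (1 2) p) (auto simp: abs_potential_eq_iff pinned_abs intro!: exI[of _ "- rep_potential p undefined"])
qed

lemma dist_abs_potential:
  "dist (abs_potential f) (abs_potential g) = var_norm (\<lambda>u. f u - g u)"
  by (rule dist_potential.abs_eq)

lemma dist_abs_potential_le: "dist (abs_potential f) (abs_potential g) \<le> 2 * dist f g"
  unfolding dist_abs_potential var_norm_le_iff[OF bounded_range_diff_bcontfun]
proof (intro allI)
  fix u v
  show "(f u - g u) - (f v - g v) \<le> 2 * dist f g"
    using dist_bounded[of f u g] dist_bounded[of f v g] by (simp add: dist_real_def)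
qed

lemma dist_pinned_le: "dist (pinned p) (pinned q) \<le> dist p q"
proof (rule dist_bound)
  fix u
  have z: "pinned r undefined = 0" for r :: "'a potential"
    using pinned_abs[of "rep_potential r" undefined] by (simp add: Quotient3_abs_rep[OF Quotient3_potential])
  have "dist p q = var_norm (\<lambda>u. pinned p u - pinned q u)"
    using dist_abs_potential[of "pinned p" "pinned q"] by (simp add: abs_pinned)
  moreover have "bounded (range (\<lambda>u. pinned p u - pinned q u))"
    by (rule bounded_range_diff_bcontfun)
  note var_norm_upper[OF this, of u undefined] var_norm_upper[OF this, of undefined u]
  ultimately show "dist (pinned p u) (pinned q u) \<le> dist p q"
    by (simp add: z dist_real_def abs_le_iff)
qed

lemma continuous_on_abs_potential: "continuous_on S abs_potential"
  by (rule lipschitz_on_continuous_on[of 2]) (auto intro!: lipschitz_onI dist_abs_potential_le)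

lemma continuous_on_pinned: "continuous_on S pinned"
  by (rule lipschitz_on_continuous_on[of 1]) (auto intro!: lipschitz_onI dist_pinned_le)

lemma Cauchy_potential_convergent:
  fixes p :: "nat \<Rightarrow> 'a::metric_space potential"
  assumes "Cauchy p"
  shows "convergent p"
proof -
  have "Cauchy (\<lambda>t. pinned (p t))"
    unfolding Cauchy_def
  proof (intro allI impI)
    fix e :: real assume "e > 0"
    with assms obtain k where "\<And>m n. m \<ge> k \<Longrightarrow> n \<ge> k \<Longrightarrow> dist (p m) (p n) < e"
      unfolding Cauchy_def by meson
    then show "\<exists>k. \<forall>m\<ge>k. \<forall>n\<ge>k. dist (pinned (p m)) (pinned (p n)) < e"
      using dist_pinned_le le_less_trans by (metis (no_types))
  qed
  then have "convergent (\<lambda>t. pinned (p t))" by (rule Cauchy_convergent)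
  then obtain h where "(\<lambda>t. pinned (p t)) \<longlonglongrightarrow> h" by (auto simp: convergent_def)
  then have "(\<lambda>t. abs_potential (pinned (p t))) \<longlonglongrightarrow> abs_potential h"
    by (rule continuous_on_tendsto_compose[OF continuous_on_abs_potential[of UNIV]]) auto
  then show ?thesis by (auto simp: abs_pinned convergent_def)
qed

lemma Cauchy_prod_convergent:
  fixes p :: "nat \<Rightarrow> 'b::metric_space \<times> 'c::metric_space"
  assumes "\<And>q :: nat \<Rightarrow> 'b. Cauchy q \<Longrightarrow> convergent q" "\<And>q :: nat \<Rightarrow> 'c. Cauchy q \<Longrightarrow> convergent q"
    and "Cauchy p"
  shows "convergent p"
proof -
  obtain a b where "(\<lambda>t. fst (p t)) \<longlonglongrightarrow> a" "(\<lambda>t. snd (p t)) \<longlonglongrightarrow> b"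
    using assms(1)[OF Cauchy_fst[OF assms(3)]] assms(2)[OF Cauchy_snd[OF assms(3)]]
    by (auto simp: convergent_def)
  from tendsto_Pair[OF this] show ?thesis by (auto simp: convergent_def)
qed

lemma separable_potential:
  assumes compact: "compact (UNIV :: 'a::metric_space set)"
  obtains D :: "'a::metric_space potential set" where "countable D" "closure D = UNIV"
proof -
  obtain D :: "('a \<Rightarrow>\<^sub>C real) set" where D: "countable D" "closure D = UNIV"
    by (rule separable_bcontfun[OF compact])
  have "abs_potential ` closure D \<subseteq> closure (abs_potential ` D)"
    by (rule image_closure_subset[OF continuous_on_abs_potential]) (auto simp: closure_subset)
  moreover have "range (abs_potential :: ('a \<Rightarrow>\<^sub>C real) \<Rightarrow> _) = UNIV"
    using abs_pinned by (metis surjI)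
  ultimately show thesis using D by (intro that[of "abs_potential ` D"]) auto
qed

section \<open>The soft C-transform as a random contraction\<close>

definition potential_ctransform ::
    "('a \<Rightarrow> 'a \<Rightarrow> real) \<Rightarrow> 'a measure \<Rightarrow> 'a::topological_space potential \<Rightarrow> 'a potential" where
  "potential_ctransform C \<mu> p = abs_potential (soft_ctransform C \<mu> (pinned p))"

text \<open>One iteration as a map on the state space: the noise is the pair of empirical measures of the
  batches of \<open>x\<close> and \<open>y\<close>. The first potential is updated with the second measure and conversely.\<close>

definition sinkhorn_step ::
    "('a \<Rightarrow> 'a \<Rightarrow> real) \<Rightarrow> 'a measure \<times> 'a measure
      \<Rightarrow> 'a::topological_space potential \<times> 'a potential \<Rightarrow> 'a potential \<times> 'a potential" where
  "sinkhorn_step C \<xi> z =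
     (potential_ctransform C (snd \<xi>) (snd z), potential_ctransform C (fst \<xi>) (fst z))"

lemma exp_weighted_le:
  fixes \<eta> u :: real
  assumes "0 \<le> \<eta>" "\<eta> \<le> 1"
  shows "exp (\<eta> * u) \<le> \<eta> * exp u + (1 - \<eta>)"
  using convex_onD[OF exp_convex, of \<eta> 0 u] assms by simp

locale lipschitz_cost =
  fixes C :: "'a::metric_space \<Rightarrow> 'a \<Rightarrow> real" and L :: real
  assumes compact: "compact (UNIV :: 'a set)"
    and lipschitz: "L-lipschitz_on UNIV (case_prod C)"
begin

text \<open>A bound on how much \<open>C u v\<close> varies with \<open>u\<close>, uniformly in \<open>v\<close>. All constants below depend on
  the cost only through it.\<close>

definition cost_osc :: real where
  "cost_osc = L * diameter (UNIV :: 'a set)"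

definition contraction_rate :: real where
  "contraction_rate = 1 - exp (- (2 * cost_osc))"

lemma cost_osc_bound: "C u' v - C u v \<le> cost_osc"
proof -
  have "\<bar>C u' v - C u v\<bar> \<le> L * dist u' u"
    using lipschitz_onD[OF lipschitz, of "(u', v)" "(u, v)"] by (simp add: dist_prod_def dist_real_def)
  also have "\<dots> \<le> cost_osc"
    unfolding cost_osc_def using compact_imp_bounded[OF compact] lipschitz_on_nonneg[OF lipschitz]
    by (intro mult_left_mono diameter_bounded_bound) auto
  finally show ?thesis by simp
qed

lemma cost_osc_nonneg: "0 \<le> cost_osc"
  using cost_osc_bound[of undefined undefined undefined] by simp

lemma contraction_rate: "0 \<le> contraction_rate" "contraction_rate < 1"
  using cost_osc_nonneg by (auto simp: contraction_rate_def)

lemma continuous_cost: "continuous_on UNIV (C u)"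
proof -
  have "continuous_on UNIV (\<lambda>v. case_prod C (u, v))"
    by (rule continuous_on_compose2[OF lipschitz_on_continuous_on[OF lipschitz]])
       (auto intro!: continuous_intros)
  then show ?thesis by simp
qed

context
  fixes \<mu> :: "'a measure"
  assumes \<mu>: "\<mu> \<in> space (prob_algebra borel)"
begin

interpretation \<mu>: prob_space \<mu> using \<mu> by (simp add: space_prob_algebra)

lemma sets_\<mu>: "sets \<mu> = sets borel"
  using \<mu> by (simp add: space_prob_algebra)

lemma integrable_continuous:
  fixes h :: "'a \<Rightarrow> real"
  assumes "continuous_on UNIV h"
  shows "integrable \<mu> h"
proof -
  obtain b where b: "\<And>v. \<bar>h v\<bar> \<le> b"
    using compact_imp_bounded[OF compact_continuous_image[OF assms compact]]
    by (auto simp: bounded_iff)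
  have "h \<in> borel_measurable \<mu>"
    unfolding measurable_cong_sets[OF sets_\<mu> refl] by (rule borel_measurable_continuous_onI) fact
  then show ?thesis
    by (intro \<mu>.integrable_const_bound[of _ b]) (simp_all add: b)
qed

definition partition_integral :: "('a \<Rightarrow>\<^sub>C real) \<Rightarrow> 'a \<Rightarrow> real" where
  "partition_integral h u = (\<integral>v. exp (h v - C u v) \<partial>\<mu>)"

lemma integrable_weight:
  fixes h :: "'a \<Rightarrow>\<^sub>C real"
  shows "integrable \<mu> (\<lambda>v. exp (h v - C u v))"
  by (intro integrable_continuous continuous_intros continuous_cost) auto

lemma soft_ctransform_eq: "soft_ctransform C \<mu> h u = - ln (partition_integral h u)"
  unfolding partition_integral_def by (rule apply_soft_ctransform[OF compact lipschitz \<mu>])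

lemma partition_integral_pos: "0 < partition_integral h u"
proof -
  have "continuous_on UNIV (\<lambda>v. exp (h v - C u v))"
    by (intro continuous_intros continuous_cost) auto
  then obtain v0 where "\<And>v. exp (h v0 - C u v0) \<le> exp (h v - C u v)"
    using continuous_attains_inf[OF compact UNIV_not_empty] by blast
  then have "exp (h v0 - C u v0) \<le> partition_integral h u"
    unfolding partition_integral_def by (intro \<mu>.integral_ge_const integrable_weight) simp
  then show ?thesis by (rule less_le_trans[rotated]) simp
qed

text \<open>Moving \<open>u\<close> changes the weight \<open>exp (g v - C u v)\<close> by a factor of at most \<open>exp cost_osc\<close>. As \<open>k\<close>
  is nonnegative, the integrals change by at most the same factor.\<close>

lemma weighted_integral_harnack:
  fixes g :: "'a \<Rightarrow>\<^sub>C real" and k :: "'a \<Rightarrow> real"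
  assumes "continuous_on UNIV k" "\<And>v. 0 \<le> k v"
  shows "(\<integral>v. exp (g v - C u' v) * k v \<partial>\<mu>) \<le> exp cost_osc * (\<integral>v. exp (g v - C u v) * k v \<partial>\<mu>)"
proof -
  have int: "integrable \<mu> (\<lambda>v. exp (g v - C u v) * k v)" for u
    by (intro integrable_continuous continuous_intros continuous_cost assms) auto
  have "(\<integral>v. exp (g v - C u' v) * k v \<partial>\<mu>) \<le> (\<integral>v. exp cost_osc * (exp (g v - C u v) * k v) \<partial>\<mu>)"
  proof (intro integral_mono int integrable_mult_right)
    fix v
    have "g v - C u' v \<le> cost_osc + (g v - C u v)" using cost_osc_bound[of u v u'] by simp
    then have "exp (g v - C u' v) \<le> exp cost_osc * exp (g v - C u v)"
      by (simp flip: exp_add)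
    then show "exp (g v - C u' v) * k v \<le> exp cost_osc * (exp (g v - C u v) * k v)"
      using assms(2)[of v] by (simp add: mult_right_mono flip: mult.assoc)
  qed
  then show ?thesis by simp
qed

lemma partition_integral_harnack: "partition_integral h u' \<le> exp cost_osc * partition_integral h u"
  using weighted_integral_harnack[of "\<lambda>_. 1" h u' u] by (simp add: partition_integral_def)

lemma soft_ctransform_osc: "soft_ctransform C \<mu> h u - soft_ctransform C \<mu> h u' \<le> cost_osc"
proof -
  have "ln (partition_integral h u') \<le> ln (exp cost_osc * partition_integral h u)"
    using partition_integral_pos by (intro ln_mono partition_integral_harnack) auto
  then show ?thesis
    using partition_integral_pos[of h u] by (simp add: soft_ctransform_eq ln_mult)
qed

text \<open>Let \<open>\<delta> = f - g\<close> and let \<open>r u\<close> be the mean of \<open>exp \<delta>\<close> under the Gibbs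
  measure with density proportional to \<open>exp (g v - C u v)\<close>; then \<open>ln (r u)\<close> is the difference of
  the two transforms at \<open>u\<close>. With \<open>a = exp (min \<delta>)\<close>, the comparison of integrals above, applied to
  the nonnegative function \<open>exp \<delta> - a\<close> and to the normalization, gives
  \<open>r u - a \<ge> \<eta> * (r u' - a)\<close> with \<open>\<eta> = exp (- 2 * cost_osc)\<close>. Thus \<open>r u\<close> is at least a convex
  combination of \<open>r u'\<close> and \<open>a\<close>, and convexity of the exponential turns this into
  \<open>ln (r u) \<ge> \<eta> * ln (r u') + (1 - \<eta>) * ln a\<close>. Since \<open>ln (r u')\<close> is at most \<open>max \<delta>\<close>, it
  exceeds \<open>ln (r u)\<close> by at most \<open>(1 - \<eta>) * (max \<delta> - min \<delta>)\<close>.\<close>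

lemma soft_ctransform_contraction:
  "var_norm (\<lambda>u. soft_ctransform C \<mu> f u - soft_ctransform C \<mu> g u)
     \<le> contraction_rate * var_norm (\<lambda>u. f u - g u)"
  unfolding var_norm_le_iff[OF bounded_range_diff_bcontfun]
proof (intro allI)
  fix u u' :: 'a
  define \<delta> where "\<delta> v = f v - g v" for v
  have cont: "continuous_on UNIV \<delta>" unfolding \<delta>_def by (intro continuous_intros) auto
  obtain p q where pq: "\<And>v. \<delta> v \<le> \<delta> p" "\<And>v. \<delta> q \<le> \<delta> v" and V: "var_norm \<delta> = \<delta> p - \<delta> q"
    using var_norm_attained[OF compact cont] by blast
  define a where "a = exp (\<delta> q)"
  define \<eta> where "\<eta> = exp (- (2 * cost_osc))"
  have \<eta>: "0 < \<eta>" "\<eta> \<le> 1" using cost_osc_nonneg by (auto simp: \<eta>_def)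
  let ?I = "partition_integral g" and ?J = "partition_integral f"
  define r where "r u = ?J u / ?I u" for u
  define excess where "excess u = (\<integral>v. exp (g v - C u v) * (exp (\<delta> v) - a) \<partial>\<mu>)" for u
  have f_eq: "exp (f v - C u v) = exp (g v - C u v) * exp (\<delta> v)" for u v
    by (simp add: \<delta>_def flip: exp_add)
  have int: "integrable \<mu> (\<lambda>v. exp (g v - C u v) * exp (\<delta> v))" for u
    using integrable_weight[of f u] by (simp add: f_eq)
  have excess_eq: "excess u = ?J u - a * ?I u" for u
  proof -
    have "excess u = (\<integral>v. exp (g v - C u v) * exp (\<delta> v) - a * exp (g v - C u v) \<partial>\<mu>)"
      unfolding excess_def by (rule Bochner_Integration.integral_cong) (simp_all add: algebra_simps)
    also have "\<dots> = ?J u - a * ?I u"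
      unfolding partition_integral_def f_eq
      by (subst Bochner_Integration.integral_diff[OF int integrable_mult_right[OF integrable_weight]]) simp
    finally show ?thesis .
  qed
  have excess_harnack: "excess u' \<le> exp cost_osc * excess u"
    unfolding excess_def a_def
    by (intro weighted_integral_harnack continuous_intros cont) (simp add: pq)
  have excess_nonneg: "0 \<le> excess u" for u
    unfolding excess_def a_def by (intro integral_nonneg_AE AE_I2) (simp add: pq)
  have r_excess: "r u - a = excess u / ?I u" for u
    using partition_integral_pos[of g u] by (simp add: r_def excess_eq diff_divide_distrib)
  have a_le: "a \<le> r u" for u
  proof -
    have "0 \<le> excess u / ?I u"
      using excess_nonneg[of u] partition_integral_pos[of g u] by (rule divide_nonneg_pos)
    then show ?thesis using r_excess[of u] by simp
  qed
  have r_le: "r u' \<le> exp (\<delta> p)"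
  proof -
    have "?J u' \<le> (\<integral>v. exp (\<delta> p) * exp (g v - C u' v) \<partial>\<mu>)"
      unfolding partition_integral_def f_eq
      by (intro integral_mono int integrable_mult_right integrable_weight)
         (simp add: pq mult.commute)
    also have "\<dots> = exp (\<delta> p) * ?I u'" by (simp add: partition_integral_def)
    finally show ?thesis
      using partition_integral_pos[of g u'] by (simp add: r_def divide_le_eq)
  qed
  have "\<eta> * (r u' - a) \<le> r u - a"
  proof -
    have "\<eta> * (r u' - a) = \<eta> * excess u' / ?I u'" by (simp add: r_excess)
    also have "\<dots> \<le> \<eta> * (exp cost_osc * excess u) / ?I u'"
      using \<eta> partition_integral_pos[of g u'] excess_harnack
      by (intro divide_right_mono mult_left_mono) auto
    also have "\<dots> = excess u / (exp cost_osc * ?I u')"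
    proof -
      have "\<eta> = 1 / (exp cost_osc * exp cost_osc)"
        by (simp add: \<eta>_def exp_minus inverse_eq_divide flip: exp_add)
      then show ?thesis by simp
    qed
    also have "\<dots> \<le> excess u / ?I u"
      using partition_integral_pos[of g] excess_nonneg[of u]
      by (intro divide_left_mono partition_integral_harnack mult_pos_pos) auto
    finally show ?thesis by (simp add: r_excess)
  qed
  then have r_lower: "\<eta> * r u' + (1 - \<eta>) * a \<le> r u" by (simp add: algebra_simps)
  define s where "s = ln (r u' / a)"
  have a_pos: "0 < a" by (simp add: a_def)
  then have r_pos: "0 < r u" for u using a_le[of u] by simp
  have exp_s: "r u' = a * exp s" using a_pos r_pos[of u'] by (simp add: s_def)
  have s_le: "s \<le> var_norm \<delta>"
  proof -
    have "exp (\<delta> q + s) \<le> exp (\<delta> p)" using r_le unfolding exp_s a_def exp_add .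
    then show ?thesis by (simp add: V)
  qed
  have "a * exp (\<eta> * s) \<le> a * (\<eta> * exp s + (1 - \<eta>))"
    using a_pos \<eta> by (intro mult_left_mono exp_weighted_le) auto
  also have "\<dots> = \<eta> * r u' + (1 - \<eta>) * a" by (simp add: exp_s algebra_simps)
  also note r_lower
  finally have "ln (a * exp (\<eta> * s)) \<le> ln (r u)" using a_pos by (intro ln_mono) auto
  then have "ln a + \<eta> * s \<le> ln (r u)" using a_pos by (simp add: ln_mult)
  moreover have "ln (r u') = ln a + s" using a_pos by (simp add: exp_s ln_mult)
  moreover have "ln (r u) = soft_ctransform C \<mu> g u - soft_ctransform C \<mu> f u" for u
    using partition_integral_pos[of f u] partition_integral_pos[of g u]
    by (simp add: r_def soft_ctransform_eq ln_div)
  ultimately have "(soft_ctransform C \<mu> f u - soft_ctransform C \<mu> g u)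
      - (soft_ctransform C \<mu> f u' - soft_ctransform C \<mu> g u') \<le> (1 - \<eta>) * s"
    by (simp add: algebra_simps)
  also have "\<dots> \<le> (1 - \<eta>) * var_norm \<delta>" using \<eta> s_le by (intro mult_left_mono) auto
  finally show "(soft_ctransform C \<mu> f u - soft_ctransform C \<mu> g u)
      - (soft_ctransform C \<mu> f u' - soft_ctransform C \<mu> g u')
      \<le> contraction_rate * var_norm (\<lambda>u. f u - g u)"
    by (simp add: contraction_rate_def \<eta>_def \<delta>_def[abs_def])
qed

text \<open>Adding a constant to the argument subtracts it from the transform, so that the transform of the
  pinned representative represents the transform of every representative.\<close>

lemma potential_ctransform_abs:
  "potential_ctransform C \<mu> (abs_potential f) = abs_potential (soft_ctransform C \<mu> f)"
  unfolding potential_ctransform_def abs_potential_eq_iff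
proof (intro exI allI)
  fix u
  have "exp (pinned (abs_potential f) v - C u v) = exp (- f undefined) * exp (f v - C u v)" for v
    by (simp add: pinned_abs flip: exp_add)
  then have "partition_integral (pinned (abs_potential f)) u = exp (- f undefined) * partition_integral f u"
    by (simp add: partition_integral_def)
  then show "soft_ctransform C \<mu> (pinned (abs_potential f)) u = soft_ctransform C \<mu> f u + f undefined"
    using partition_integral_pos[of f u] by (simp add: soft_ctransform_eq ln_mult)
qed

lemma potential_ctransform_contraction:
  "dist (potential_ctransform C \<mu> p) (potential_ctransform C \<mu> q) \<le> contraction_rate * dist p q"
  using soft_ctransform_contraction[of "pinned p" "pinned q"] dist_abs_potential[of "pinned p" "pinned q"]
  by (simp add: potential_ctransform_def dist_abs_potential abs_pinned)

lemma potential_ctransform_bounded: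
  "dist (potential_ctransform C \<mu> p) (abs_potential 0) \<le> cost_osc"
  unfolding potential_ctransform_def dist_abs_potential var_norm_le_iff[OF bounded_range_diff_bcontfun]
  using soft_ctransform_osc by simp

end

text \<open>Both the measure and the potential may be random. For each point \<open>u\<close> the value at \<open>u\<close> is the
  integral of a jointly measurable function against a measurable kernel; pointwise measurability
  then suffices in C(X).\<close>

lemma measurable_potential_ctransform:
  assumes m: "m \<in> N \<rightarrow>\<^sub>M prob_algebra borel" and p: "p \<in> borel_measurable N"
  shows "(\<lambda>w. potential_ctransform C (m w) (p w)) \<in> borel_measurable N"
proof -
  obtain A :: "'a set" where A: "countable A" "closure A = UNIV"
    by (rule compact_UNIV_imp_separable[OF compact])
  have pinned_meas: "(\<lambda>w. pinned (p w) v) \<in> borel_measurable N" for v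
  proof -
    have "1-lipschitz_on UNIV (\<lambda>h :: 'a \<Rightarrow>\<^sub>C real. h v)"
      by (rule lipschitz_onI) (auto intro: dist_bounded)
    then have "continuous_on UNIV (\<lambda>h :: 'a \<Rightarrow>\<^sub>C real. h v)" by (rule lipschitz_on_continuous_on)
    from continuous_on_compose2[OF this continuous_on_pinned]
    have "(\<lambda>q. pinned q v) \<in> borel_measurable borel"
      by (intro borel_measurable_continuous_onI) auto
    then show ?thesis by (rule measurable_compose[OF p])
  qed
  have "(\<lambda>w. soft_ctransform C (m w) (pinned (p w)) u) \<in> borel_measurable N" for u
  proof -
    have meas: "(\<lambda>(w, v). pinned (p w) v - C u v) \<in> borel_measurable (N \<Otimes>\<^sub>M borel)"
      by (rule borel_measurable_caratheodory[OF A])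
         (auto intro!: pinned_meas borel_measurable_diff continuous_intros continuous_cost)
    have "(\<lambda>w. \<integral>\<^sup>+v. ennreal (exp (pinned (p w) v - C u v)) \<partial>m w) \<in> borel_measurable N"
      by (rule nn_integral_measurable_subprob_algebra2[OF _ measurable_prob_algebraD[OF m]])
         (use meas in \<open>simp add: case_prod_beta\<close>)
    then have "(\<lambda>w. - ln (enn2real (\<integral>\<^sup>+v. ennreal (exp (pinned (p w) v - C u v)) \<partial>m w)))
        \<in> borel_measurable N"
      by simp
    moreover have "soft_ctransform C (m w) (pinned (p w)) u
        = - ln (enn2real (\<integral>\<^sup>+v. ennreal (exp (pinned (p w) v - C u v)) \<partial>m w))" if "w \<in> space N" for w
    proof -
      have mw: "m w \<in> space (prob_algebra borel)" using measurable_space[OF m that] .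
      show ?thesis
        unfolding apply_soft_ctransform[OF compact lipschitz mw]
        by (subst integral_eq_nn_integral)
           (auto intro: borel_measurable_integrable[OF integrable_weight[OF mw]])
    qed
    ultimately show ?thesis by (simp cong: measurable_cong)
  qed
  then have "(\<lambda>w. soft_ctransform C (m w) (pinned (p w))) \<in> borel_measurable N"
    by (rule borel_measurable_bcontfun_pointwise[OF compact])
  then show ?thesis
    unfolding potential_ctransform_def
    by (rule measurable_compose)
       (intro borel_measurable_continuous_onI continuous_on_abs_potential)
qed

lemma measurable_sinkhorn_step:
  "(\<lambda>(\<xi>, z). sinkhorn_step C \<xi> z)
     \<in> (prob_algebra borel \<Otimes>\<^sub>M prob_algebra borel) \<Otimes>\<^sub>M borel \<rightarrow>\<^sub>M borel"
proof -
  obtain D :: "'a potential set" where D: "countable D" "closure D = UNIV"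
    by (rule separable_potential[OF compact])
  have fst_meas: "fst \<in> borel \<rightarrow>\<^sub>M (borel :: 'a potential measure)"
    and snd_meas: "snd \<in> borel \<rightarrow>\<^sub>M (borel :: 'a potential measure)"
    by (intro borel_measurable_continuous_onI continuous_intros)+
  show ?thesis
    unfolding sinkhorn_step_def case_prod_beta
    by (intro borel_measurable_Pair_separable[OF D D] measurable_potential_ctransform
        measurable_compose[OF measurable_snd fst_meas] measurable_compose[OF measurable_snd snd_meas]
        measurable_compose[OF measurable_fst measurable_fst]
        measurable_compose[OF measurable_fst measurable_snd])
qed

text \<open>The step acts on each factor as a contraction, after exchanging the factors, so that it contracts
  the Euclidean combination of the two distances at the same rate.\<close>

lemma sinkhorn_step_contraction:
  assumes \<xi>: "\<xi> \<in> space (prob_algebra borel \<Otimes>\<^sub>M prob_algebra borel)"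
  shows "dist (sinkhorn_step C \<xi> z) (sinkhorn_step C \<xi> z') \<le> contraction_rate * dist z z'"
proof -
  have \<mu>: "fst \<xi> \<in> space (prob_algebra borel)" "snd \<xi> \<in> space (prob_algebra borel)"
    using \<xi> by (auto simp: space_pair_measure)
  let ?d = "dist (fst z) (fst z')" and ?e = "dist (snd z) (snd z')"
  have "dist (sinkhorn_step C \<xi> z) (sinkhorn_step C \<xi> z')
      \<le> sqrt ((contraction_rate * ?e)\<^sup>2 + (contraction_rate * ?d)\<^sup>2)"
    unfolding sinkhorn_step_def dist_prod_def fst_conv snd_conv
    by (intro real_sqrt_le_mono add_mono power_mono potential_ctransform_contraction \<mu>) auto
  also have "\<dots> = sqrt (contraction_rate\<^sup>2 * (?d\<^sup>2 + ?e\<^sup>2))"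
    by (simp add: algebra_simps)
  also have "\<dots> = contraction_rate * dist z z'"
    using contraction_rate by (simp add: real_sqrt_mult dist_prod_def)
  finally show ?thesis .
qed

lemma sinkhorn_step_bounded:
  assumes \<xi>: "\<xi> \<in> space (prob_algebra borel \<Otimes>\<^sub>M prob_algebra borel)"
  shows "dist (sinkhorn_step C \<xi> z) (abs_potential 0, abs_potential 0) \<le> 2 * cost_osc"
proof -
  have \<mu>: "fst \<xi> \<in> space (prob_algebra borel)" "snd \<xi> \<in> space (prob_algebra borel)"
    using \<xi> by (auto simp: space_pair_measure)
  show ?thesis
    unfolding sinkhorn_step_def dist_prod_def fst_conv snd_conv
    by (rule order_trans[OF sqrt_sum_squares_le_sum])
       (use potential_ctransform_bounded[OF \<mu>(1), of "fst z"] potential_ctransform_bounded[OF \<mu>(2), of "snd z"] in auto)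
qed

lemma potential_pair_sinkhorn:
  assumes "\<And>t. \<mu> t \<in> space (prob_algebra borel)" "\<And>t. \<nu> t \<in> space (prob_algebra borel)"
  shows "potential_pair (sinkhorn C \<mu> \<nu> z (Suc t))
    = sinkhorn_step C (\<mu> t, \<nu> t) (potential_pair (sinkhorn C \<mu> \<nu> z t))"
  by (simp add: potential_pair_def sinkhorn_step_def potential_ctransform_abs assms
      map_prod_def split: prod.split)

end

section \<open>Mini-batches\<close>

lemma minibatch_measure_cong:
  assumes n: "n \<ge> 1" and eq: "\<And>i. i \<in> {1..n} \<Longrightarrow> x (i + n * t) = x' i"
  shows "minibatch_measure n x t = minibatch_measure n x' 0"
proof (rule measure_eqI)
  show "sets (minibatch_measure n x t) = sets (minibatch_measure n x' 0)"
    by (simp add: minibatch_measure_def)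
  fix A assume "A \<in> sets (minibatch_measure n x t)"
  then have A: "A \<in> sets borel" by (simp add: minibatch_measure_def)
  have "(\<Sum>i = n * t + 1..n * (t + 1). indicator A (x i) :: real)
      = (\<Sum>i = 1 + n * t..n + n * t. indicator A (x i))"
    by (simp add: algebra_simps)
  also have "\<dots> = (\<Sum>i = 1..n. indicator A (x (i + n * t)))"
    by (rule sum.shift_bounds_cl_nat_ivl)
  also have "\<dots> = (\<Sum>i = n * 0 + 1..n * (0 + 1). indicator A (x' i))"
    by (intro sum.cong) (auto simp: eq)
  finally show "emeasure (minibatch_measure n x t) A = emeasure (minibatch_measure n x' 0) A"
    by (simp only: emeasure_minibatch_measure[OF n A])
qed

lemma minibatch_measure_prob:
  assumes "n \<ge> 1"
  shows "minibatch_measure n x t \<in> space (prob_algebra borel)"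
proof -
  have "prob_space (uniform_count_measure {n * t + 1..n * (t + 1)})"
    using assms by (intro prob_space_uniform_count_measure) auto
  then show ?thesis
    unfolding minibatch_measure_def space_prob_algebra
    by (auto intro!: prob_space.prob_space_distr
        simp: measurable_def sets_uniform_count_measure space_uniform_count_measure)
qed

lemma measurable_minibatch_measure:
  assumes n: "n \<ge> 1" and X: "\<And>i. i \<in> {1..n} \<Longrightarrow> (\<lambda>w. X w i) \<in> N \<rightarrow>\<^sub>M borel"
  shows "(\<lambda>w. minibatch_measure n (X w) 0) \<in> N \<rightarrow>\<^sub>M prob_algebra borel"
proof (rule measurable_prob_algebraI)
  show prob_space: "prob_space (minibatch_measure n (X w) 0)" for w
    using minibatch_measure_prob[OF n, of "X w" 0] by (simp add: space_prob_algebra)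
  show "(\<lambda>w. minibatch_measure n (X w) 0) \<in> N \<rightarrow>\<^sub>M subprob_algebra borel"
  proof (rule measurable_subprob_algebra)
    fix A :: "'b set" assume A: "A \<in> sets borel"
    have [measurable]: "(\<lambda>w. indicator A (X w i) :: real) \<in> borel_measurable N" if "i \<in> {1..n}" for i
      by (rule measurable_compose[OF X[OF that]]) (use A in measurable)
    show "(\<lambda>w. emeasure (minibatch_measure n (X w) 0) A) \<in> borel_measurable N"
      unfolding emeasure_minibatch_measure[OF n A]
      by (intro measurable_compose[OF _ measurable_ennreal] borel_measurable_times
          borel_measurable_sum) auto
  qed (rule prob_space_imp_subprob_space[OF prob_space], simp add: minibatch_measure_def)
qed

text \<open>The samples are indexed by \<open>Inl i\<close> for \<open>x\<close> and \<open>Inr i\<close> for \<open>y\<close>. The map \<open>batch_index n t\<close>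
  sends the slots of the batch at time 0 to the indices of the samples in the batch at time \<open>t\<close>.
  Each pair of empirical measures is then the same function \<open>batch_pair\<close> of the samples in the
  slots.\<close>

definition batch_index :: "nat \<Rightarrow> nat \<Rightarrow> nat + nat \<Rightarrow> nat + nat" where
  "batch_index n t = map_sum (\<lambda>i. i + n * t) (\<lambda>i. i + n * t)"

definition batch_slots :: "nat \<Rightarrow> (nat + nat) set" where
  "batch_slots n = {1..n} <+> {1..n}"

lemma inj_batch_index: "inj (batch_index n t)"
  unfolding batch_index_def by (intro sum.inj_map injI) auto

lemma batch_index_image_subset: "batch_index n t ` batch_slots n \<subseteq> {1..} <+> {1..}"
  by (auto simp: batch_index_def batch_slots_def)

lemma batch_number_unique:
  fixes i j n s t :: nat
  assumes eq: "i + n * s = j + n * t" and i: "Suc 0 \<le> i" "i \<le> n" and j: "Suc 0 \<le> j" "j \<le> n"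
  shows "s = t"
proof -
  obtain i' j' where ij: "i = Suc i'" "j = Suc j'" using i j by (meson Suc_le_D)
  then have "(i' + n * s) div n = s" "(j' + n * t) div n = t" using i j by simp_all
  moreover have "i' + n * s = j' + n * t" using eq ij by simp
  ultimately show ?thesis by simp
qed

lemma disjoint_batches: "disjoint_family (\<lambda>t. batch_index n t ` batch_slots n)"
  unfolding disjoint_family_on_def
proof (intro ballI impI equals0I)
  fix s t k assume "s \<noteq> t" "k \<in> batch_index n s ` batch_slots n \<inter> batch_index n t ` batch_slots n"
  then show False
    by (auto simp: batch_index_def batch_slots_def dest: batch_number_unique)
qed

definition batch_pair :: "nat \<Rightarrow> (nat + nat \<Rightarrow> 'a::topological_space) \<Rightarrow> 'a measure \<times> 'a measure" where
  "batch_pair n w = (minibatch_measure n (\<lambda>i. w (Inl i)) 0, minibatch_measure n (\<lambda>i. w (Inr i)) 0)"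

abbreviation (input) batch_space :: "('a::topological_space measure \<times> 'a measure) measure" where
  "batch_space \<equiv> prob_algebra borel \<Otimes>\<^sub>M prob_algebra borel"

lemma measurable_batch_pair:
  assumes "n \<ge> 1" 
  shows "batch_pair n \<in> (\<Pi>\<^sub>M j\<in>batch_slots n. borel) \<rightarrow>\<^sub>M batch_space"
  unfolding batch_pair_def
  by (intro measurable_Pair measurable_minibatch_measure measurable_component_singleton assms)
     (auto simp: batch_slots_def)

text \<open>The law of the samples in the slots does not depend on \<open>t\<close>: restrict the independent family to
  the indices of one batch and reindex the product measure.\<close>

lemma (in prob_space) distr_iid_batch:
  fixes X :: "nat + nat \<Rightarrow> 'a \<Rightarrow> 'b::topological_space"
  assumes n: "n \<ge> 1"
    and indep: "indep_vars (\<lambda>_. borel) X ({1..} <+> {1..})"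
    and law: "\<And>i. i \<in> {1..} <+> {1..} \<Longrightarrow> distr M borel (X i) = case_sum (\<lambda>_. \<alpha>) (\<lambda>_. \<beta>) i"
  shows "distr M (\<Pi>\<^sub>M j\<in>batch_slots n. borel) (\<lambda>\<omega>. \<lambda>j\<in>batch_slots n. X (batch_index n t j) \<omega>)
    = (\<Pi>\<^sub>M j\<in>batch_slots n. case_sum (\<lambda>_. \<alpha>) (\<lambda>_. \<beta>) j)"
proof -
  let ?J = "batch_slots n" and ?\<sigma> = "batch_index n t"
  let ?K = "?\<sigma> ` ?J"
  let ?law = "\<lambda>i. distr M borel (X i)"
  have rv: "X i \<in> M \<rightarrow>\<^sub>M borel" if "i \<in> ?K" for i
    using indep that batch_index_image_subset[of n t] unfolding indep_vars_def2 by blast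
  have J: "?J \<noteq> {}" using n by (auto simp: batch_slots_def)
  have "indep_vars (\<lambda>_. borel) X ?K"
    by (rule indep_vars_subset[OF indep batch_index_image_subset])
  then have eq: "distr M (\<Pi>\<^sub>M i\<in>?K. borel) (\<lambda>\<omega>. \<lambda>i\<in>?K. X i \<omega>) = (\<Pi>\<^sub>M i\<in>?K. ?law i)"
    using J by (subst (asm) indep_vars_iff_distr_eq_PiM') (auto intro: rv)
  have sets: "sets (\<Pi>\<^sub>M j\<in>?J. ?law (?\<sigma> j)) = sets (\<Pi>\<^sub>M j\<in>?J. (borel :: 'b measure))"
    by (intro sets_PiM_cong) auto
  have reindex: "(\<lambda>v. \<lambda>j\<in>?J. v (?\<sigma> j)) \<in> (\<Pi>\<^sub>M i\<in>?K. (borel :: 'b measure)) \<rightarrow>\<^sub>M (\<Pi>\<^sub>M j\<in>?J. borel)"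
    by (intro measurable_restrict measurable_component_singleton) auto
  have "distr M (\<Pi>\<^sub>M j\<in>?J. borel) (\<lambda>\<omega>. \<lambda>j\<in>?J. X (?\<sigma> j) \<omega>)
      = distr (distr M (\<Pi>\<^sub>M i\<in>?K. borel) (\<lambda>\<omega>. \<lambda>i\<in>?K. X i \<omega>)) (\<Pi>\<^sub>M j\<in>?J. borel) (\<lambda>v. \<lambda>j\<in>?J. v (?\<sigma> j))"
    by (subst distr_distr[OF reindex])
       (auto intro!: measurable_restrict rv distr_cong restrict_ext)
  also have "\<dots> = distr (\<Pi>\<^sub>M i\<in>?K. ?law i) (\<Pi>\<^sub>M j\<in>?J. ?law (?\<sigma> j)) (\<lambda>v. \<lambda>j\<in>?J. v (?\<sigma> j))"
    unfolding eq by (intro distr_cong sets[symmetric] refl)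
  also have "\<dots> = (\<Pi>\<^sub>M j\<in>?J. ?law (?\<sigma> j))"
    by (intro distr_PiM_reindex prob_space_distr rv inj_on_subset[OF inj_batch_index]) auto
  also have "\<dots> = (\<Pi>\<^sub>M j\<in>?J. case_sum (\<lambda>_. \<alpha>) (\<lambda>_. \<beta>) j)"
    using batch_index_image_subset[of n t]
    by (intro PiM_cong refl) (subst law, auto simp: batch_index_def split: sum.splits)
  finally show ?thesis .
qed

section \<open>Convergence of the randomized Sinkhorn iterations\<close>

lemma history_cong:
  assumes "sets S = sets S'"
  shows "history M S Y t = history M S' Y t"
  unfolding history_def vimage_algebra_def using sets_PiM_cong[OF refl assms, of "{..t}"] by simp

lemma continuous_on_potential_pair: "continuous_on S potential_pair"
  unfolding potential_pair_def map_prod_def case_prod_beta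
  by (intro continuous_on_Pair continuous_on_compose2[OF continuous_on_abs_potential[of UNIV]]
      continuous_intros) auto

theorem proposition1:
  fixes C :: "'a::metric_space \<Rightarrow> 'a \<Rightarrow> real" and L :: real
    and \<alpha> \<beta> :: "'a measure" and n :: nat
    and M :: "'w measure" and x y :: "nat \<Rightarrow> 'w \<Rightarrow> 'a"
  defines "\<alpha>h \<equiv> \<lambda>t \<omega>. minibatch_measure n (\<lambda>i. x i \<omega>) t"
    and "\<beta>h \<equiv> \<lambda>t \<omega>. minibatch_measure n (\<lambda>i. y i \<omega>) t"
  defines "Z \<equiv> \<lambda>f0 g0 t \<omega>. potential_pair (sinkhorn C (\<lambda>s. \<alpha>h s \<omega>) (\<lambda>s. \<beta>h s \<omega>) (f0, g0) t)"
  assumes compact: "compact (UNIV :: 'a set)"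
    and symmetric: "\<And>u v. C u v = C v u"
    and lipschitz: "L-lipschitz_on UNIV (\<lambda>(u, v). C u v)"
    and \<alpha>: "\<alpha> \<in> space (prob_algebra borel)"
    and \<beta>: "\<beta> \<in> space (prob_algebra borel)"
    and n: "n \<ge> 1"
    and M: "prob_space M"
    and independent: "prob_space.indep_vars M (\<lambda>_. borel) (case_sum x y) ({1..} <+> {1..})"
    and x_law: "\<And>i. i \<ge> 1 \<Longrightarrow> distr M borel (x i) = \<alpha>"
    and y_law: "\<And>i. i \<ge> 1 \<Longrightarrow> distr M borel (y i) = \<beta>"
  shows "\<exists>(K :: 'a potential \<times> 'a potential \<Rightarrow> ('a potential \<times> 'a potential) measure)
          (Q :: (('a \<Rightarrow>\<^sub>C real) \<times> ('a \<Rightarrow>\<^sub>C real)) measure).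
     Q \<in> space (prob_algebra borel) \<and>
     stationary_distribution borel K (distr Q borel potential_pair) \<and>
     (\<forall>f0 g0.
        (\<forall>t. Z f0 g0 t \<in>
           history M (prob_algebra borel \<Otimes>\<^sub>M prob_algebra borel) (\<lambda>s \<omega>. (\<alpha>h s \<omega>, \<beta>h s \<omega>)) t
             \<rightarrow>\<^sub>M borel) \<and>
        homogeneous_markov_chain M borel K (Z f0 g0) \<and>
        converges_in_law M (Z f0 g0) (distr Q borel potential_pair))"
proof -
  interpret M: prob_space M by (rule M)
  interpret cost: lipschitz_cost C L by unfold_locales (fact compact lipschitz)+
  let ?X = "case_sum x y" and ?J = "batch_slots n"
  define \<xi> where "\<xi> t \<omega> = (\<alpha>h t \<omega>, \<beta>h t \<omega>)" for t \<omega>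
  define \<nu> where "\<nu> = distr M batch_space (\<xi> 0)"
  have sets_\<nu>: "sets \<nu> = sets (batch_space :: ('a measure \<times> 'a measure) measure)"
    by (simp add: \<nu>_def)
  have space_\<nu>: "space \<nu> = space (batch_space :: ('a measure \<times> 'a measure) measure)"
    by (rule sets_eq_imp_space_eq[OF sets_\<nu>])
  have X: "?X i \<in> M \<rightarrow>\<^sub>M borel" if "i \<in> {1..} <+> {1..}" for i
    using independent that unfolding M.indep_vars_def2 by blast
  have \<xi>_batch: "\<xi> t \<omega> = batch_pair n (\<lambda>j\<in>?J. ?X (batch_index n t j) \<omega>)" for t \<omega>
    unfolding \<xi>_def batch_pair_def \<alpha>h_def \<beta>h_def
    by (intro arg_cong2[where f=Pair] minibatch_measure_cong n)
       (auto simp: batch_slots_def batch_index_def)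
  have slots: "(\<lambda>\<omega>. \<lambda>j\<in>?J. ?X (batch_index n t j) \<omega>) \<in> M \<rightarrow>\<^sub>M (\<Pi>\<^sub>M j\<in>?J. borel)" for t
    using batch_index_image_subset[of n t] by (intro measurable_restrict X) auto
  have \<xi>_meas: "\<xi> t \<in> M \<rightarrow>\<^sub>M batch_space" for t
    using measurable_compose[OF slots measurable_batch_pair[OF n]] by (simp add: \<xi>_batch[abs_def])
  have \<xi>_distr: "distr M batch_space (\<xi> t)
      = distr (\<Pi>\<^sub>M j\<in>?J. case_sum (\<lambda>_. \<alpha>) (\<lambda>_. \<beta>) j) batch_space (batch_pair n)" for t
  proof -
    have "distr M batch_space (\<xi> t) = distr (distr M (\<Pi>\<^sub>M j\<in>?J. borel)
        (\<lambda>\<omega>. \<lambda>j\<in>?J. ?X (batch_index n t j) \<omega>)) batch_space (batch_pair n)"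
      by (subst distr_distr[OF measurable_batch_pair[OF n] slots]) (simp add: comp_def \<xi>_batch[abs_def])
    also have "distr M (\<Pi>\<^sub>M j\<in>?J. borel) (\<lambda>\<omega>. \<lambda>j\<in>?J. ?X (batch_index n t j) \<omega>)
        = (\<Pi>\<^sub>M j\<in>?J. case_sum (\<lambda>_. \<alpha>) (\<lambda>_. \<beta>) j)"
      by (rule M.distr_iid_batch[OF n independent]) (auto simp: x_law y_law)
    finally show ?thesis .
  qed
  have \<xi>_law: "distr M \<nu> (\<xi> t) = \<nu>" for t
  proof -
    have "distr M \<nu> (\<xi> t) = distr M batch_space (\<xi> t)" by (rule distr_cong) (simp_all add: sets_\<nu>)
    also have "\<dots> = \<nu>" unfolding \<nu>_def \<xi>_distr ..
    finally show ?thesis .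
  qed
  \<comment> \<open>The batches use disjoint sets of samples.\<close>
  have \<xi>_indep: "M.indep_vars (\<lambda>_. \<nu>) \<xi> UNIV"
  proof -
    define G where "G t v = batch_pair n (\<lambda>j\<in>?J. v (batch_index n t j))" for t and v :: "nat + nat \<Rightarrow> 'a"
    have "M.indep_vars (\<lambda>t. \<Pi>\<^sub>M i\<in>batch_index n t ` ?J. borel)
        (\<lambda>t \<omega>. \<lambda>i\<in>batch_index n t ` ?J. ?X i \<omega>) UNIV"
      by (rule M.indep_vars_restrict[OF independent batch_index_image_subset disjoint_batches])
    moreover have "G t \<in> (\<Pi>\<^sub>M i\<in>batch_index n t ` ?J. borel) \<rightarrow>\<^sub>M \<nu>" for t
    proof -
      have "(\<lambda>v :: nat + nat \<Rightarrow> 'a. \<lambda>j\<in>?J. v (batch_index n t j))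
          \<in> (\<Pi>\<^sub>M i\<in>batch_index n t ` ?J. borel) \<rightarrow>\<^sub>M (\<Pi>\<^sub>M j\<in>?J. borel)"
        by (intro measurable_restrict measurable_component_singleton) auto
      from measurable_compose[OF this measurable_batch_pair[OF n]]
      show ?thesis
        unfolding G_def by (simp add: measurable_cong_sets[OF refl sets_\<nu>])
    qed
    ultimately have "M.indep_vars (\<lambda>_. \<nu>) (\<lambda>t \<omega>. G t (\<lambda>i\<in>batch_index n t ` ?J. ?X i \<omega>)) UNIV"
      by (rule M.indep_vars_compose2)
    moreover have "G t (\<lambda>i\<in>batch_index n t ` ?J. ?X i \<omega>) = \<xi> t \<omega>" for t \<omega>
      unfolding G_def \<xi>_batch by (intro arg_cong[where f="batch_pair n"] restrict_ext) simp
    ultimately show ?thesis by (simp add: fun_eq_iff cong: M.indep_vars_cong)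
  qed
  \<comment> \<open>Every transform has oscillation at most cost_osc; the two components move by at most twice that.\<close>
  let ?z0 = "(abs_potential 0, abs_potential 0) :: 'a potential \<times> 'a potential"
  interpret chain: random_contraction \<nu> "sinkhorn_step C" cost.contraction_rate "2 * cost.cost_osc" ?z0
  proof (intro random_contraction.intro random_contraction_axioms.intro)
    show "prob_space \<nu>" unfolding \<nu>_def by (rule M.prob_space_distr[OF \<xi>_meas])
    show "convergent b" if "Cauchy b" for b :: "nat \<Rightarrow> 'a potential \<times> 'a potential"
      by (rule Cauchy_prod_convergent[OF Cauchy_potential_convergent Cauchy_potential_convergent that])
    show "(\<lambda>(\<xi>, z). sinkhorn_step C \<xi> z) \<in> \<nu> \<Otimes>\<^sub>M borel \<rightarrow>\<^sub>M borel"
      using cost.measurable_sinkhorn_step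
      by (simp add: measurable_cong_sets[OF sets_pair_measure_cong[OF sets_\<nu> refl] refl])
  qed (auto simp: space_\<nu> intro: cost.sinkhorn_step_contraction cost.sinkhorn_step_bounded
      cost.contraction_rate)
  \<comment> \<open>Pinned representatives lift the invariant law from the potentials to pairs of functions.\<close>
  define Q where "Q = distr chain.invariant_law borel (\<lambda>z. (pinned (fst z), pinned (snd z)))"
  have prob_law: "prob_space chain.invariant_law" and sets_law: "sets chain.invariant_law = sets borel"
    using chain.stationary_invariant_law by (auto simp: stationary_distribution_def space_prob_algebra)
  have pinned_meas: "(\<lambda>z. (pinned (fst z), pinned (snd z))) \<in> chain.invariant_law \<rightarrow>\<^sub>M borel"
    unfolding measurable_cong_sets[OF sets_law refl]
    by (intro borel_measurable_continuous_onI continuous_on_Pair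
        continuous_on_compose2[OF continuous_on_pinned[of UNIV]] continuous_intros) auto
  have pair_meas: "potential_pair \<in> borel \<rightarrow>\<^sub>M borel"
    by (intro borel_measurable_continuous_onI continuous_on_potential_pair)
  have Q_prob: "Q \<in> space (prob_algebra borel)"
    unfolding Q_def space_prob_algebra
    using prob_space.prob_space_distr[OF prob_law pinned_meas] by simp
  have Q_law: "distr Q borel potential_pair = chain.invariant_law"
  proof -
    have "distr Q borel potential_pair = distr chain.invariant_law borel (\<lambda>z. z)"
      unfolding Q_def
      by (subst distr_distr[OF pair_meas pinned_meas]) (simp add: comp_def potential_pair_def abs_pinned)
    also have "\<dots> = chain.invariant_law" by (rule distr_id2) (simp add: sets_law)
    finally show ?thesis .
  qed
  have Z: "Z f0 g0 t \<omega> = forward_iterate (sinkhorn_step C) t (\<lambda>i. \<xi> i \<omega>) (potential_pair (f0, g0))"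
    for f0 g0 t \<omega>
  proof (induction t)
    case (Suc t)
    have "Z f0 g0 (Suc t) \<omega> = sinkhorn_step C (\<xi> t \<omega>) (Z f0 g0 t \<omega>)"
      unfolding Z_def \<xi>_def
      by (rule cost.potential_pair_sinkhorn) (simp_all add: \<alpha>h_def \<beta>h_def minibatch_measure_prob[OF n])
    then show ?case by (simp add: Suc.IH)
  qed (simp add: Z_def)
  have history: "history M \<nu> \<xi> t = history M batch_space (\<lambda>s \<omega>. (\<alpha>h s \<omega>, \<beta>h s \<omega>)) t" for t
    unfolding \<xi>_def[abs_def] by (rule history_cong[OF sets_\<nu>])
  show ?thesis
  proof (intro exI conjI allI)
    show "Q \<in> space (prob_algebra borel)" by (rule Q_prob)
    show "stationary_distribution borel chain.transition (distr Q borel potential_pair)"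
      unfolding Q_law by (rule chain.stationary_invariant_law)
    fix f0 g0
    interpret Zchain: random_contraction_chain \<nu> "sinkhorn_step C" cost.contraction_rate
      "2 * cost.cost_osc" ?z0 M \<xi> "potential_pair (f0, g0)"
      by unfold_locales (fact \<xi>_indep \<xi>_law)+
    have Z_eq: "Z f0 g0 = (\<lambda>t \<omega>. forward_iterate (sinkhorn_step C) t (\<lambda>i. \<xi> i \<omega>) (potential_pair (f0, g0)))"
      by (intro ext Z)
    show "Z f0 g0 t \<in> history M batch_space (\<lambda>s \<omega>. (\<alpha>h s \<omega>, \<beta>h s \<omega>)) t \<rightarrow>\<^sub>M borel" for t
      using Zchain.measurable_chain_history[of t] unfolding Z_eq history .
    show "homogeneous_markov_chain M borel chain.transition (Z f0 g0)"
      unfolding Z_eq by (rule Zchain.homogeneous_markov_chain_chain)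
    show "converges_in_law M (Z f0 g0) (distr Q borel potential_pair)"
      unfolding Z_eq Q_law by (rule Zchain.converges_in_law_chain)
  qed
qed

end
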